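(* Let $\mathcal{M}$ be a semifinite von Neumann algebra equipped with a faithful normal semifinite trace $\tau$. Let $\mathcal{E}\subseteq\mathcal{M}\cap S_0(\tau)$ be an ideal of $\mathcal{M}$ consisting of $\tau$-compact operators, equipped with a Banach norm $\|\cdot\|_{\mathcal{E}}$ such that $(\mathcal{E},\|\cdot\|_{\mathcal{E}})$ is a Banach $\mathcal{M}$-bimodule, and let $\delta:\mathcal{E}\to\mathcal{E}$ be a derivation. Then $\delta$ is a continuous mapping from $(\mathcal{E},\|\cdot\|_{\mathcal{E}})$ to itself.
   Context: $\mathcal{M}$ acts on a Hilbert space $H$; ideals are two-sided. A linear operator $x$ with domain in $H$ is affiliated with $\mathcal{M}$ if $yx\subseteq xy$ for all $y$ in the commutant $\mathcal{M}'$. A closed densely defined operator $x$ affiliated with $\mathcal{M}$ is $\tau$-measurable if $\tau(e^{|x|}(\lambda,\infty))<\infty$ for some $\lambda>0$, where $e^{|x|}$ is the spectral measure of $|x|$. The set $S(\tau)$ of $\tau$-measurable operators is a $*$-algebra under strong sum and strong product. For $x\in S(\tau)$ the generalized singular value function is $\mu(t;x)=\inf\{s\ge 0:\tau(e^{|x|}(s,\infty))\le t\}$, $t\ge 0$. The set of $\tau$-compact operators is $S_0(\tau)=\{x\in S(\tau):\lim_{t\to\infty}\mu(t;x)=0\}$. A Banach $\mathcal{M}$-bimodule is a linear subspace $\mathbb{E}$ of $S(\tau)$ with a norm $\|\cdot\|_{\mathbb{E}}$ such that $(\mathbb{E},\|\cdot\|_{\mathbb{E}})$ is a Banach space and, whenever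 $x\in\mathbb{E}$ and $u,v\in\mathcal{M}$, one has $uxv\in\mathbb{E}$ and $\|uxv\|_{\mathbb{E}}\le\|u\|_{\mathcal{B}(H)}\|v\|_{\mathcal{B}(H)}\|x\|_{\mathbb{E}}$. A derivation from an algebra $A$ into an $A$-bimodule $\mathbb{E}$ is a linear map $\delta:A\to\mathbb{E}$ with $\delta(xy)=\delta(x)y+x\delta(y)$ for all $x,y\in A$. No continuity is assumed. *)

theory Defs
  imports "HOL-Analysis.Analysis"
begin

text \<open>Complex Hilbert spaces; the inner product is linear in the first argument.\<close>

class complex_hilbert_space = banach +
  fixes scaleC :: "complex \<Rightarrow> 'a \<Rightarrow> 'a"
    and cinner :: "'a \<Rightarrow> 'a \<Rightarrow> complex"
  assumes scaleC_add_right: "scaleC c (x + y) = scaleC c x + scaleC c y"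
    and scaleC_add_left: "scaleC (c + d) x = scaleC c x + scaleC d x"
    and scaleC_scaleC: "scaleC c (scaleC d x) = scaleC (c * d) x"
    and scaleR_scaleC: "scaleR r x = scaleC (complex_of_real r) x"
    and cinner_commute: "cinner x y = cnj (cinner y x)"
    and cinner_add_left: "cinner (x + y) z = cinner x z + cinner y z"
    and cinner_scaleC_left: "cinner (scaleC c x) y = c * cinner x y"
    and cinner_self_nonneg: "cinner x x \<in> nonneg_Reals"
    and cinner_self_eq_0_iff: "cinner x x = 0 \<longleftrightarrow> x = 0"
    and norm_eq_sqrt_cinner: "norm x = sqrt (Re (cinner x x))"

text \<open>
  A (possibly unbounded, partially defined) operator is represented by its graph. Thus
  inclusion of operators is inclusion of sets, the identity operator is \<^const>\<open>Id\<close>, the domain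
  is \<^const>\<open>Domain\<close>, and an operator is closed iff its graph is a closed set. The operations
  below are the pointwise ones on the natural domains.
\<close>

type_synonym 'a lop = "('a \<times> 'a) set"

definition linear_op :: "'a::complex_hilbert_space lop \<Rightarrow> bool" where
  "linear_op x \<longleftrightarrow> single_valued x \<and> (0, 0) \<in> x \<and>
     (\<forall>\<xi> \<eta> \<xi>' \<eta>'. (\<xi>, \<eta>) \<in> x \<longrightarrow> (\<xi>', \<eta>') \<in> x \<longrightarrow> (\<xi> + \<xi>', \<eta> + \<eta>') \<in> x) \<and>
     (\<forall>c \<xi> \<eta>. (\<xi>, \<eta>) \<in> x \<longrightarrow> (scaleC c \<xi>, scaleC c \<eta>) \<in> x)"

definition densely_defined :: "'a::complex_hilbert_space lop \<Rightarrow> bool" where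
  "densely_defined x \<longleftrightarrow> closure (Domain x) = UNIV"

definition op_apply :: "'a::complex_hilbert_space lop \<Rightarrow> 'a \<Rightarrow> 'a" where
  "op_apply x \<xi> = (THE \<eta>. (\<xi>, \<eta>) \<in> x)"

definition op_zero :: "'a::complex_hilbert_space lop" where
  "op_zero = UNIV \<times> {0}"

definition op_add :: "'a::complex_hilbert_space lop \<Rightarrow> 'a lop \<Rightarrow> 'a lop" where
  "op_add x y = {(\<xi>, \<eta> + \<zeta>) | \<xi> \<eta> \<zeta>. (\<xi>, \<eta>) \<in> x \<and> (\<xi>, \<zeta>) \<in> y}"

definition op_scale :: "complex \<Rightarrow> 'a::complex_hilbert_space lop \<Rightarrow> 'a lop" where
  "op_scale c x = {(\<xi>, scaleC c \<eta>) | \<xi> \<eta>. (\<xi>, \<eta>) \<in> x}"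

definition op_diff :: "'a::complex_hilbert_space lop \<Rightarrow> 'a lop \<Rightarrow> 'a lop" where
  "op_diff x y = op_add x (op_scale (- 1) y)"

text \<open>Operator products apply the right factor first, opposite to relation composition.\<close>

definition op_mult :: "'a::complex_hilbert_space lop \<Rightarrow> 'a lop \<Rightarrow> 'a lop" where
  "op_mult x y = y O x"

definition op_adj :: "'a::complex_hilbert_space lop \<Rightarrow> 'a lop" where
  "op_adj x = {(\<eta>, \<zeta>). \<forall>(\<xi>, \<xi>') \<in> x. cinner \<xi>' \<eta> = cinner \<xi> \<zeta>}"

definition op_positive :: "'a::complex_hilbert_space lop \<Rightarrow> bool" where
  "op_positive x \<longleftrightarrow> (\<forall>(\<xi>, \<eta>) \<in> x. cinner \<eta> \<xi> \<in> nonneg_Reals)"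

definition bounded_ops :: "'a::complex_hilbert_space lop set" where
  "bounded_ops = {range (\<lambda>\<xi>. (\<xi>, f \<xi>)) | f.
     bounded_linear f \<and> (\<forall>c \<xi>. f (scaleC c \<xi>) = scaleC c (f \<xi>))}"

definition op_norm :: "'a::complex_hilbert_space lop \<Rightarrow> real" where
  "op_norm x = onorm (op_apply x)"

definition projection_op :: "'a::complex_hilbert_space lop \<Rightarrow> bool" where
  "projection_op p \<longleftrightarrow> p \<in> bounded_ops \<and> op_adj p = p \<and> op_mult p p = p"

definition commutant :: "'a::complex_hilbert_space lop set \<Rightarrow> 'a lop set" where
  "commutant M = {y \<in> bounded_ops. \<forall>x \<in> M. op_mult x y = op_mult y x}"

text \<open>That \<open>M\<close> is a unital subalgebra is automatic, as every commutant is one.\<close>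

definition von_neumann_algebra :: "'a::complex_hilbert_space lop set \<Rightarrow> bool" where
  "von_neumann_algebra M \<longleftrightarrow>
     M \<subseteq> bounded_ops \<and> (\<forall>x \<in> M. op_adj x \<in> M) \<and> commutant (commutant M) = M"

definition two_sided_ideal ::
    "'a::complex_hilbert_space lop set \<Rightarrow> 'a lop set \<Rightarrow> bool" where
  "two_sided_ideal M I \<longleftrightarrow> I \<subseteq> M \<and> op_zero \<in> I \<and>
     (\<forall>x \<in> I. \<forall>y \<in> I. op_add x y \<in> I) \<and> (\<forall>c. \<forall>x \<in> I. op_scale c x \<in> I) \<and>
     (\<forall>u \<in> M. \<forall>x \<in> I. op_mult u x \<in> I \<and> op_mult x u \<in> I)"

definition pos_cone :: "'a::complex_hilbert_space lop set \<Rightarrow> 'a lop set" where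
  "pos_cone M = {x \<in> M. op_positive x}"

definition op_le :: "'a::complex_hilbert_space lop \<Rightarrow> 'a lop \<Rightarrow> bool" where
  "op_le x y \<longleftrightarrow> op_positive (op_diff y x)"

text \<open>
  A trace is a function on the positive cone of \<open>M\<close> with values in \<open>[0, \<infinity>]\<close>;
  its values elsewhere are irrelevant. In \<^typ>\<open>ennreal\<close>, \<open>0 * \<infinity> = 0\<close>.
\<close>

definition trace_on ::
    "'a::complex_hilbert_space lop set \<Rightarrow> ('a lop \<Rightarrow> ennreal) \<Rightarrow> bool" where
  "trace_on M \<tau> \<longleftrightarrow>
     (\<forall>x \<in> pos_cone M. \<forall>y \<in> pos_cone M. \<tau> (op_add x y) = \<tau> x + \<tau> y) \<and>
     (\<forall>c \<ge> 0. \<forall>x \<in> pos_cone M. \<tau> (op_scale (complex_of_real c) x) = ennreal c * \<tau> x) \<and>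
     (\<forall>x \<in> M. \<tau> (op_mult (op_adj x) x) = \<tau> (op_mult x (op_adj x)))"

definition faithful_trace ::
    "'a::complex_hilbert_space lop set \<Rightarrow> ('a lop \<Rightarrow> ennreal) \<Rightarrow> bool" where
  "faithful_trace M \<tau> \<longleftrightarrow> (\<forall>x \<in> pos_cone M. \<tau> x = 0 \<longrightarrow> x = op_zero)"

definition op_directed :: "'a::complex_hilbert_space lop set \<Rightarrow> bool" where
  "op_directed D \<longleftrightarrow> D \<noteq> {} \<and> (\<forall>x \<in> D. \<forall>y \<in> D. \<exists>z \<in> D. op_le x z \<and> op_le y z)"

definition is_sup_in ::
    "'a::complex_hilbert_space lop set \<Rightarrow> 'a lop set \<Rightarrow> 'a lop \<Rightarrow> bool" where
  "is_sup_in C D x \<longleftrightarrow> x \<in> C \<and> (\<forall>y \<in> D. op_le y x) \<and>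
     (\<forall>z \<in> C. (\<forall>y \<in> D. op_le y z) \<longrightarrow> op_le x z)"

definition normal_trace ::
    "'a::complex_hilbert_space lop set \<Rightarrow> ('a lop \<Rightarrow> ennreal) \<Rightarrow> bool" where
  "normal_trace M \<tau> \<longleftrightarrow>
     (\<forall>D x. D \<subseteq> pos_cone M \<and> op_directed D \<and> is_sup_in (pos_cone M) D x
        \<longrightarrow> \<tau> x = (SUP y \<in> D. \<tau> y))"

definition semifinite_trace ::
    "'a::complex_hilbert_space lop set \<Rightarrow> ('a lop \<Rightarrow> ennreal) \<Rightarrow> bool" where
  "semifinite_trace M \<tau> \<longleftrightarrow>
     (\<forall>x \<in> pos_cone M. x \<noteq> op_zero \<longrightarrow>
        (\<exists>y \<in> pos_cone M. y \<noteq> op_zero \<and> op_le y x \<and> \<tau> y < \<infinity>))"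

definition fns_trace ::
    "'a::complex_hilbert_space lop set \<Rightarrow> ('a lop \<Rightarrow> ennreal) \<Rightarrow> bool" where
  "fns_trace M \<tau> \<longleftrightarrow>
     trace_on M \<tau> \<and> faithful_trace M \<tau> \<and> normal_trace M \<tau> \<and> semifinite_trace M \<tau>"

definition semifinite_von_neumann_algebra ::
    "'a::complex_hilbert_space lop set \<Rightarrow> bool" where
  "semifinite_von_neumann_algebra M \<longleftrightarrow> von_neumann_algebra M \<and> (\<exists>\<tau>. fns_trace M \<tau>)"

definition projection_valued_measure ::
    "(real set \<Rightarrow> 'a::complex_hilbert_space lop) \<Rightarrow> bool" where
  "projection_valued_measure P \<longleftrightarrow>
     (\<forall>B \<in> sets borel. projection_op (P B)) \<and> P UNIV = Id \<and>
     (\<forall>A \<in> sets borel. \<forall>B \<in> sets borel. P (A \<inter> B) = op_mult (P A) (P B)) \<and>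
     (\<forall>A \<xi>. range A \<subseteq> sets borel \<longrightarrow> disjoint_family A \<longrightarrow>
        (\<lambda>n::nat. op_apply (P (A n)) \<xi>) sums op_apply (P (\<Union>n. A n)) \<xi>)"

definition scalar_spectral_measure ::
    "(real set \<Rightarrow> 'a::complex_hilbert_space lop) \<Rightarrow> 'a \<Rightarrow> real measure" where
  "scalar_spectral_measure P \<xi> =
     measure_of UNIV (sets borel) (\<lambda>B. ennreal (Re (cinner (op_apply (P B) \<xi>) \<xi>)))"

text \<open>
  \<open>a = \<integral> t dP(t)\<close>: the domain of \<open>a\<close> consists of the vectors \<open>\<xi>\<close> with
  \<open>\<integral> t\<^sup>2 d\<langle>P(t)\<xi>, \<xi>\<rangle> < \<infinity>\<close>, and \<open>\<langle>a\<xi>, \<xi>\<rangle> = \<integral> t d\<langle>P(t)\<xi>, \<xi>\<rangle>\<close> there, which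
  determines the linear operator \<open>a\<close> by polarization.
\<close>

definition is_spectral_measure ::
    "'a::complex_hilbert_space lop \<Rightarrow> (real set \<Rightarrow> 'a lop) \<Rightarrow> bool" where
  "is_spectral_measure a P \<longleftrightarrow> projection_valued_measure P \<and>
     Domain a = {\<xi>. (\<integral>\<^sup>+ t. ennreal (t\<^sup>2) \<partial>scalar_spectral_measure P \<xi>) < \<infinity>} \<and>
     (\<forall>(\<xi>, \<eta>) \<in> a. cinner \<eta> \<xi> = complex_of_real (\<integral> t. t \<partial>scalar_spectral_measure P \<xi>))"

text \<open>
  For a self-adjoint operator the spectral theorem gives existence, and uniqueness on Borel
  sets; the choice only affects the irrelevant values on non-Borel sets.
\<close>

definition spectral_measure ::
    "'a::complex_hilbert_space lop \<Rightarrow> real set \<Rightarrow> 'a lop" where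
  "spectral_measure a = (SOME P. is_spectral_measure a P)"

text \<open>
  \<open>|x|\<close> is the unique positive self-adjoint operator with square \<open>x\<^sup>* x\<close>, for \<open>x\<close> closed and
  densely defined.
\<close>

definition op_abs :: "'a::complex_hilbert_space lop \<Rightarrow> 'a lop" where
  "op_abs x = (SOME a. linear_op a \<and> densely_defined a \<and> op_adj a = a \<and> op_positive a \<and>
                 op_mult a a = op_mult (op_adj x) x)"

definition affiliated :: "'a::complex_hilbert_space lop set \<Rightarrow> 'a lop \<Rightarrow> bool" where
  "affiliated M x \<longleftrightarrow> linear_op x \<and> (\<forall>y \<in> commutant M. op_mult y x \<subseteq> op_mult x y)"

definition tau_measurable ::
    "'a::complex_hilbert_space lop set \<Rightarrow> ('a lop \<Rightarrow> ennreal) \<Rightarrow> 'a lop set" where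
  "tau_measurable M \<tau> = {x. affiliated M x \<and> closed x \<and> densely_defined x \<and>
     (\<exists>s::real. s > 0 \<and> \<tau> (spectral_measure (op_abs x) {s<..}) < \<infinity>)}"

text \<open>The value may be \<open>\<infinity>\<close> at \<open>t = 0\<close>.\<close>

definition sing_val ::
    "('a::complex_hilbert_space lop \<Rightarrow> ennreal) \<Rightarrow> real \<Rightarrow> 'a lop \<Rightarrow> ennreal" where
  "sing_val \<tau> t x =
     Inf {ennreal s | s. s \<ge> 0 \<and> \<tau> (spectral_measure (op_abs x) {s<..}) \<le> ennreal t}"

definition tau_compact ::
    "'a::complex_hilbert_space lop set \<Rightarrow> ('a lop \<Rightarrow> ennreal) \<Rightarrow> 'a lop set" where
  "tau_compact M \<tau> = {x \<in> tau_measurable M \<tau>. ((\<lambda>t. sing_val \<tau> t x) \<longlongrightarrow> 0) at_top}"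

text \<open>
  The algebra operations of the \<open>\<tau>\<close>-measurable operators: closures of the pointwise ones. They
  agree with the latter on everywhere defined bounded operators, whose graphs are closed.
\<close>

definition strong_add :: "'a::complex_hilbert_space lop \<Rightarrow> 'a lop \<Rightarrow> 'a lop" where
  "strong_add x y = closure (op_add x y)"

definition strong_scale :: "complex \<Rightarrow> 'a::complex_hilbert_space lop \<Rightarrow> 'a lop" where
  "strong_scale c x = closure (op_scale c x)"

definition strong_mult :: "'a::complex_hilbert_space lop \<Rightarrow> 'a lop \<Rightarrow> 'a lop" where
  "strong_mult x y = closure (op_mult x y)"

definition strong_diff :: "'a::complex_hilbert_space lop \<Rightarrow> 'a lop \<Rightarrow> 'a lop" where
  "strong_diff x y = strong_add x (strong_scale (- 1) y)"

definition strong_subspace ::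
    "'a::complex_hilbert_space lop set \<Rightarrow> 'a lop set \<Rightarrow> bool" where
  "strong_subspace S E \<longleftrightarrow> E \<subseteq> S \<and> op_zero \<in> E \<and>
     (\<forall>x \<in> E. \<forall>y \<in> E. strong_add x y \<in> E) \<and> (\<forall>c. \<forall>x \<in> E. strong_scale c x \<in> E)"

definition norm_on :: "'a::complex_hilbert_space lop set \<Rightarrow> ('a lop \<Rightarrow> real) \<Rightarrow> bool" where
  "norm_on E N \<longleftrightarrow>
     (\<forall>x \<in> E. 0 \<le> N x \<and> (N x = 0 \<longleftrightarrow> x = op_zero)) \<and>
     (\<forall>x \<in> E. \<forall>y \<in> E. N (strong_add x y) \<le> N x + N y) \<and>
     (\<forall>c. \<forall>x \<in> E. N (strong_scale c x) = cmod c * N x)"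

definition complete_wrt ::
    "'a::complex_hilbert_space lop set \<Rightarrow> ('a lop \<Rightarrow> real) \<Rightarrow> bool" where
  "complete_wrt E N \<longleftrightarrow>
     (\<forall>X::nat \<Rightarrow> 'a lop. (\<forall>n. X n \<in> E) \<longrightarrow>
        (\<forall>\<epsilon>>0. \<exists>k. \<forall>m\<ge>k. \<forall>n\<ge>k. N (strong_diff (X m) (X n)) < \<epsilon>) \<longrightarrow>
        (\<exists>x \<in> E. (\<lambda>n. N (strong_diff (X n) x)) \<longlonglongrightarrow> 0))"

definition banach_bimodule ::
    "'a::complex_hilbert_space lop set \<Rightarrow> ('a lop \<Rightarrow> ennreal) \<Rightarrow>
     'a lop set \<Rightarrow> ('a lop \<Rightarrow> real) \<Rightarrow> bool" where
  "banach_bimodule M \<tau> E N \<longleftrightarrow>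
     strong_subspace (tau_measurable M \<tau>) E \<and> norm_on E N \<and> complete_wrt E N \<and>
     (\<forall>x \<in> E. \<forall>u \<in> M. \<forall>v \<in> M.
        strong_mult (strong_mult u x) v \<in> E \<and>
        N (strong_mult (strong_mult u x) v) \<le> op_norm u * op_norm v * N x)"

definition derivation ::
    "'a::complex_hilbert_space lop set \<Rightarrow> 'a lop set \<Rightarrow> ('a lop \<Rightarrow> 'a lop) \<Rightarrow> bool" where
  "derivation A E \<delta> \<longleftrightarrow>
     (\<forall>x \<in> A. \<delta> x \<in> E) \<and>
     (\<forall>x \<in> A. \<forall>y \<in> A. \<delta> (strong_add x y) = strong_add (\<delta> x) (\<delta> y)) \<and>
     (\<forall>c. \<forall>x \<in> A. \<delta> (strong_scale c x) = strong_scale c (\<delta> x)) \<and>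
     (\<forall>x \<in> A. \<forall>y \<in> A. \<delta> (strong_mult x y) =
        strong_add (strong_mult (\<delta> x) y) (strong_mult x (\<delta> y)))"

definition norm_continuous_on ::
    "'a::complex_hilbert_space lop set \<Rightarrow> ('a lop \<Rightarrow> real) \<Rightarrow> ('a lop \<Rightarrow> 'a lop) \<Rightarrow> bool" where
  "norm_continuous_on E N f \<longleftrightarrow>
     (\<forall>x \<in> E. \<forall>\<epsilon>>0. \<exists>d>0. \<forall>y \<in> E.
        N (strong_diff y x) < d \<longrightarrow> N (strong_diff (f y) (f x)) < \<epsilon>)"

end

theory Submission imports Defs begin

text \<open>
  Suppose that the separating space \<open>S = {y. \<exists>x\<^sub>n \<rightarrow> 0. \<delta> x\<^sub>n \<rightarrow> y}\<close> of \<open>\<delta>\<close> is nonzero.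
  It absorbs multiplication by \<open>\<E>\<close> on both
  sides, and a gliding hump argument shows that no infinite sequence of pairwise orthogonal
  self-adjoint elements of \<open>\<M>\<close> consists of elements that do not annihilate \<open>S\<close>. Hence some corner
  \<open>k\<M>k\<close> with \<open>kS \<noteq> 0\<close> cannot be split into two such orthogonal pieces. As the positive and negative
  parts of \<open>g - c\<close> form an orthogonal pair for every real \<open>c\<close>, elements of this corner are scalar as
  far as \<open>S\<close> can see, which gives a projection \<open>0 \<noteq> e \<in> S\<close> with \<open>e\<M>e = \<complex>e\<close>. If \<open>x\<^sub>n \<rightarrow> 0\<close> and
  \<open>\<delta> x\<^sub>n \<rightarrow> e\<close>, then \<open>e x\<^sub>n e = \<lambda>\<^sub>n e\<close> with \<open>\<lambda>\<^sub>n \<rightarrow> 0\<close>, so the Leibniz rule for \<open>\<delta>(e x\<^sub>n e)\<close> gives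
  \<open>e = 0\<close> in the limit. Therefore \<open>S = 0\<close>, and \<open>\<delta>\<close> is continuous by the closed graph theorem.
\<close>

section \<open>The closed graph theorem\<close>

text \<open>The ideal carries a norm of its own on a subset of the operator type, so a carrier and a
  norm function replace the type class \<open>banach\<close>.\<close>

locale banach_on =
  fixes V :: "'b::real_vector set" and N :: "'b \<Rightarrow> real"
  assumes V_zero: "0 \<in> V"
    and V_add: "\<And>x y. x \<in> V \<Longrightarrow> y \<in> V \<Longrightarrow> x + y \<in> V"
    and V_scaleR: "\<And>r x. x \<in> V \<Longrightarrow> r *\<^sub>R x \<in> V"
    and N_nonneg: "\<And>x. x \<in> V \<Longrightarrow> 0 \<le> N x"
    and N_eq_0_iff: "\<And>x. x \<in> V \<Longrightarrow> N x = 0 \<longleftrightarrow> x = 0"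
    and N_triangle: "\<And>x y. x \<in> V \<Longrightarrow> y \<in> V \<Longrightarrow> N (x + y) \<le> N x + N y"
    and N_scaleR: "\<And>r x. x \<in> V \<Longrightarrow> N (r *\<^sub>R x) = \<bar>r\<bar> * N x"
    and N_complete: "\<And>X. (\<And>n::nat. X n \<in> V) \<Longrightarrow>
        (\<And>\<epsilon>. \<epsilon> > 0 \<Longrightarrow> \<exists>k. \<forall>m\<ge>k. \<forall>n\<ge>k. N (X m - X n) < \<epsilon>) \<Longrightarrow>
        \<exists>x\<in>V. (\<lambda>n. N (X n - x)) \<longlonglongrightarrow> 0"
begin

lemma V_minus: "x \<in> V \<Longrightarrow> - x \<in> V"
  using V_scaleR[of x "-1"] by simp

lemma V_diff: "x \<in> V \<Longrightarrow> y \<in> V \<Longrightarrow> x - y \<in> V"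
  using V_add[of x "- y"] V_minus by simp

lemma V_sum: "(\<And>i. i \<in> I \<Longrightarrow> f i \<in> V) \<Longrightarrow> sum f I \<in> V"
  by (induction I rule: infinite_finite_induct) (auto simp: V_zero V_add)

lemma N_zero [simp]: "N 0 = 0"
  using N_eq_0_iff V_zero by blast

lemma N_minus: "x \<in> V \<Longrightarrow> N (- x) = N x"
  using N_scaleR[of x "-1"] by simp

lemma N_minus_commute: "x \<in> V \<Longrightarrow> y \<in> V \<Longrightarrow> N (x - y) = N (y - x)"
  using N_minus[OF V_diff, of x y] by simp

lemma N_diff_le: "x \<in> V \<Longrightarrow> y \<in> V \<Longrightarrow> N (x - y) \<le> N x + N y"
  using N_triangle[of x "- y"] V_minus N_minus by simp

lemma N_le_diff: "x \<in> V \<Longrightarrow> y \<in> V \<Longrightarrow> N x \<le> N (x - y) + N y"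
  using N_triangle[of "x - y" y] V_diff by simp

lemma N_sum:
  fixes f :: "'c \<Rightarrow> 'b"
  shows "finite I \<Longrightarrow> (\<And>i. i \<in> I \<Longrightarrow> f i \<in> V) \<Longrightarrow> N (sum f I) \<le> (\<Sum>i\<in>I. N (f i))"
proof (induction I rule: finite_induct)
  case (insert i I)
  then show ?case
    using N_triangle[of "f i" "sum f I"] by (force intro: V_sum)
qed auto

lemma N_limit_le:
  assumes "\<And>n. X n \<in> V" "x \<in> V" "(\<lambda>n. N (X n - x)) \<longlonglongrightarrow> 0" "\<And>n. N (X n) \<le> B"
  shows "N x \<le> B"
proof -
  have "N x \<le> N (X n - x) + B" for n
    using N_le_diff[of x "X n"] N_minus_commute[of x "X n"] assms(1)[of n] assms(4)[of n] assms(2) by auto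
  moreover have "(\<lambda>n. N (X n - x) + B) \<longlonglongrightarrow> 0 + B"
    by (intro tendsto_intros assms)
  ultimately show ?thesis
    using LIMSEQ_le_const[of _ "0 + B" "N x"] by auto
qed

text \<open>Geometric decay makes the partial sums Cauchy, and \<open>2 * B\<close> is the sum of
  the majorant. This serves both the successive approximation in the closed graph theorem and the
  gliding hump.\<close>

lemma geometric_series:
  assumes X: "\<And>n. X n \<in> V" and le: "\<And>n. N (X n) \<le> B * (1/2)^n"
  obtains s where "s \<in> V" "(\<lambda>n. N ((\<Sum>i<n. X i) - s)) \<longlonglongrightarrow> 0" "N s \<le> 2 * B"
proof -
  let ?S = "\<lambda>n. \<Sum>i<n. X i"
  have B: "0 \<le> B"
    using N_nonneg[OF X[of 0]] le[of 0] by simp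
  have S: "?S n \<in> V" for n
    by (rule V_sum) (rule X)
  have tail: "N (\<Sum>i=m..<n. X i) \<le> 2 * B * (1/2)^m" if "m \<le> n" for m n
  proof -
    have "N (\<Sum>i=m..<n. X i) \<le> (\<Sum>i=m..<n. N (X i))"
      by (rule N_sum) (auto simp: X)
    also have "\<dots> \<le> (\<Sum>i=m..<n. B * (1/2)^i)"
      by (rule sum_mono) (rule le)
    also have "\<dots> = 2 * B * (1/2)^m - 2 * B * (1/2)^n"
      using that by (induction n rule: dec_induct) (simp_all add: algebra_simps)
    also have "\<dots> \<le> 2 * B * (1/2)^m"
      using B by simp
    finally show ?thesis .
  qed
  have diff: "?S n - ?S m = (\<Sum>i=m..<n. X i)" if "m \<le> n" for m n
    using sum_diff_nat_ivl[of 0 m n X] that by (simp add: atLeast0LessThan)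
  have small: "N (?S m - ?S n) \<le> 2 * B * (1/2)^k" if "k \<le> m" "k \<le> n" for m n k
  proof -
    have *: "N (?S m - ?S n) \<le> 2 * B * (1/2)^k" if "k \<le> n" "n \<le> m" for m n
    proof -
      have "2 * B * (1/2)^n \<le> 2 * B * (1/2)^k"
        using B that by (intro mult_left_mono power_decreasing) auto
      then show ?thesis
        using tail[of n m] diff[of n m] that by simp
    qed
    show ?thesis
      using *[of n m] *[of m n] that N_minus_commute[OF S S, of m n] by (cases "n \<le> m") auto
  qed
  have "(\<lambda>k. 2 * B * (1/2::real)^k) \<longlonglongrightarrow> 2 * B * 0"
    by (intro tendsto_intros LIMSEQ_power_zero) auto
  then have lim: "(\<lambda>k. 2 * B * (1/2::real)^k) \<longlonglongrightarrow> 0"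
    by simp
  have "\<exists>k. \<forall>m\<ge>k. \<forall>n\<ge>k. N (?S m - ?S n) < \<epsilon>" if e: "\<epsilon> > 0" for \<epsilon>
  proof -
    obtain k where "2 * B * (1/2)^k < \<epsilon>"
      using order_tendstoD(2)[OF lim e] eventually_happens trivial_limit_sequentially by blast
    then show ?thesis
      using small by (meson le_less_trans)
  qed
  then obtain s where s: "s \<in> V" "(\<lambda>n. N (?S n - s)) \<longlonglongrightarrow> 0"
    using N_complete[of ?S] S by blast
  moreover have "N (?S n) \<le> 2 * B" for n
    using small[of 0 n 0] N_minus[OF S, of n] by simp
  ultimately have "N s \<le> 2 * B"
    using N_limit_le[OF S s] by blast
  then show thesis
    using that s by blast
qed

text \<open>\<open>Metric_space\<close> asks for nonnegativity and symmetry at all arguments, while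
  \<open>N\<close> is controlled only on \<open>V\<close>; the value 0 elsewhere supplies
  both.\<close>

definition N_dist :: "'b \<Rightarrow> 'b \<Rightarrow> real" where
  "N_dist x y = (if x \<in> V \<and> y \<in> V then N (x - y) else 0)"

lemma Metric_space_N: "Metric_space V N_dist"
proof
  show "0 \<le> N_dist x y" for x y
    by (simp add: N_dist_def N_nonneg V_diff)
  show "N_dist x y = N_dist y x" for x y
    by (simp add: N_dist_def N_minus_commute)
  show "(N_dist x y = 0) = (x = y)" if "x \<in> V" "y \<in> V" for x y
    using that N_eq_0_iff[of "x - y"] V_diff by (simp add: N_dist_def)
  show "N_dist x z \<le> N_dist x y + N_dist y z" if "x \<in> V" "y \<in> V" "z \<in> V" for x y z
    using that N_triangle[of "x - y" "y - z"] V_diff by (simp add: N_dist_def)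
qed

lemma mcomplete_N: "Metric_space.mcomplete V N_dist"
proof -
  interpret Metric_space V N_dist
    by (rule Metric_space_N)
  show ?thesis
    unfolding mcomplete_def
  proof (intro allI impI)
    fix \<sigma> assume \<sigma>: "MCauchy \<sigma>"
    then have V: "\<sigma> n \<in> V" for n
      by (auto simp: MCauchy_def)
    have "\<exists>k. \<forall>m\<ge>k. \<forall>n\<ge>k. N (\<sigma> m - \<sigma> n) < \<epsilon>" if "\<epsilon> > 0" for \<epsilon>
      using \<sigma> that V by (auto simp: MCauchy_def N_dist_def)
    then obtain x where "x \<in> V" "(\<lambda>n. N (\<sigma> n - x)) \<longlonglongrightarrow> 0"
      using N_complete[of \<sigma>] V by blast
    then show "\<exists>x. limitin mtopology \<sigma> x sequentially"
      using V by (auto simp: limitin_metric_dist_null N_dist_def)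
  qed
qed

text \<open>\<open>T_closed\<close> says that the separating space of \<open>T\<close> vanishes,
  which for linear \<open>T\<close> is closedness of the graph. Baire's theorem makes
  \<open>T\<close> bounded up to small errors, and successive approximation, as for the open mapping
  theorem, removes the errors.\<close>

theorem closed_graph:
  assumes T_V: "\<And>x. x \<in> V \<Longrightarrow> T x \<in> V"
    and T_add: "\<And>x y. x \<in> V \<Longrightarrow> y \<in> V \<Longrightarrow> T (x + y) = T x + T y"
    and T_scaleR: "\<And>r x. x \<in> V \<Longrightarrow> T (r *\<^sub>R x) = r *\<^sub>R T x"
    and T_closed: "\<And>X y. (\<And>n::nat. X n \<in> V) \<Longrightarrow> y \<in> V \<Longrightarrow> (\<lambda>n. N (X n)) \<longlonglongrightarrow> 0 \<Longrightarrow>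
          (\<lambda>n. N (T (X n) - y)) \<longlonglongrightarrow> 0 \<Longrightarrow> y = 0"
  obtains K where "\<And>x. x \<in> V \<Longrightarrow> N (T x) \<le> K * N x"
proof -
  interpret Metric_space V N_dist
    by (rule Metric_space_N)
  have T_zero: "T 0 = 0"
    using T_scaleR[OF V_zero, of 0] by simp
  have T_diff: "T (x - y) = T x - T y" if "x \<in> V" "y \<in> V" for x y
    using T_add[of x "-1 *\<^sub>R y"] T_scaleR[of y "-1"] V_minus that by simp
  have T_sum: "T (sum f I) = (\<Sum>i\<in>I. T (f i))" if "\<And>i. i \<in> I \<Longrightarrow> f i \<in> V" for f and I :: "nat set"
    using that by (induction I rule: infinite_finite_induct) (auto simp: T_zero T_add V_sum)
  \<comment> \<open>The closed sets \<open>F n\<close> cover \<open>V\<close>, so by completeness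
    one of them has an interior point.\<close>
  define F where "F n = mtopology closure_of {x \<in> V. N (T x) \<le> real n}" for n
  have "\<exists>n. mtopology interior_of F n \<noteq> {}"
  proof (rule ccontr)
    assume "\<not> ?thesis"
    then have "mtopology interior_of \<Union>(range F) = {}"
      by (intro metric_Baire_category_alt mcomplete_N) (auto simp: F_def)
    moreover have "V \<subseteq> \<Union>(range F)"
    proof
      fix x assume "x \<in> V"
      moreover obtain n where "N (T x) \<le> real n"
        using real_arch_simple by blast
      ultimately have "x \<in> F n"
        unfolding F_def by (intro closure_of_subset[THEN subsetD]) auto
      then show "x \<in> \<Union>(range F)"
        by blast
    qed
    then have "V \<subseteq> mtopology interior_of \<Union>(range F)"
      by (intro interior_of_maximal) (use openin_topspace[of mtopology] in auto)
    ultimately show False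
      using V_zero by blast
  qed
  then obtain n x0 where "x0 \<in> mtopology interior_of F n"
    by blast
  then obtain r where x0: "x0 \<in> V" and r: "r > 0" "mball x0 r \<subseteq> F n"
    using openin_interior_of[of mtopology "F n"] interior_of_subset[of mtopology "F n"]
    unfolding openin_mtopology by blast
  have approx: "\<exists>a\<in>V. N (x0 + x - a) < \<epsilon> \<and> N (T a) \<le> n" if x: "x \<in> V" "N x < r" "\<epsilon> > 0" for x \<epsilon>
  proof -
    have "x0 + x \<in> mball x0 r"
      using x x0 V_add by (simp add: in_mball N_dist_def N_minus)
    then have "x0 + x \<in> mtopology closure_of {x \<in> V. N (T x) \<le> real n}"
      using r(2) F_def by blast
    then obtain a where "a \<in> V" "N (T a) \<le> n" "a \<in> mball (x0 + x) \<epsilon>"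
      using \<open>\<epsilon> > 0\<close> by (auto simp: metric_closure_of)
    then show ?thesis
      by (auto simp: N_dist_def intro!: bexI[of _ a])
  qed
  \<comment> \<open>Subtracting approximants of \<open>x0 + x\<close> and of \<open>x0\<close> moves
    the ball to the origin, at the price of doubling the bound.\<close>
  have approx0: "\<exists>a\<in>V. N (x - a) < \<epsilon> \<and> N (T a) \<le> 2 * n" if x: "x \<in> V" "N x < r" "\<epsilon> > 0" for x \<epsilon>
  proof -
    obtain a where a: "a \<in> V" "N (x0 + x - a) < \<epsilon> / 2" "N (T a) \<le> n"
      using approx[of x "\<epsilon> / 2"] x by auto
    obtain b where b: "b \<in> V" "N (x0 + 0 - b) < \<epsilon> / 2" "N (T b) \<le> n"
      using approx[of 0 "\<epsilon> / 2"] x V_zero r by auto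
    have eq: "x - (a - b) = (x0 + x - a) - (x0 + 0 - b)"
      by simp
    have "N (x - (a - b)) \<le> N (x0 + x - a) + N (x0 + 0 - b)"
      unfolding eq using x0 a b x V_zero by (intro N_diff_le V_diff V_add)
    then have "N (x - (a - b)) < \<epsilon>"
      using a b by linarith
    moreover have "N (T (a - b)) \<le> 2 * n"
      using N_diff_le[of "T a" "T b"] a b T_V by (simp add: T_diff)
    ultimately show ?thesis
      using V_diff[OF a(1) b(1)] by blast
  qed
  \<comment> \<open>Vectors will be rescaled to norm \<open>r / 2\<close>, where the bound is
    \<open>2 * n\<close>; the quotient is \<open>C\<close>.\<close>
  define C where "C = 4 * real n / r"
  have C: "C \<ge> 0"
    using r by (simp add: C_def)
  have approx1: "\<exists>a\<in>V. N (x - a) < \<epsilon> \<and> N (T a) \<le> C * N x" if x: "x \<in> V" "\<epsilon> > 0" for x \<epsilon>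
  proof (cases "x = 0")
    case True
    then show ?thesis
      using V_zero that by (intro bexI[of _ 0]) (auto simp: T_zero)
  next
    case False
    then have pos: "N x > 0"
      using N_nonneg N_eq_0_iff that by (metis less_eq_real_def)
    define t where "t = r / (2 * N x)"
    have t: "t > 0"
      using pos r by (simp add: t_def)
    have "N (t *\<^sub>R x) = r / 2"
      using pos x r by (simp add: N_scaleR t_def)
    then have "N (t *\<^sub>R x) < r" "0 < t * \<epsilon>"
      using r t x by simp_all
    from approx0[OF V_scaleR[OF x(1)] this] obtain a where a: "a \<in> V" "N (t *\<^sub>R x - a) < t * \<epsilon>" "N (T a) \<le> 2 * n"
      by blast
    let ?a = "(1 / t) *\<^sub>R a"
    have "x - ?a = (1 / t) *\<^sub>R (t *\<^sub>R x - a)"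
      using t by (simp add: scaleR_right_diff_distrib)
    then have "N (x - ?a) = (1 / t) * N (t *\<^sub>R x - a)"
      using t N_scaleR[OF V_diff[OF V_scaleR[OF x(1)] a(1)], of "1 / t" t] by simp
    then have "N (x - ?a) < \<epsilon>"
      using a(2) t by (simp add: pos_divide_less_eq mult.commute)
    moreover have "N (T ?a) \<le> (1 / t) * (2 * n)"
      using a t N_scaleR[OF T_V[OF a(1)]] by (simp add: T_scaleR divide_right_mono)
    moreover have "(1 / t) * (2 * n) = C * N x"
      by (simp add: C_def t_def)
    ultimately show ?thesis
      using V_scaleR[OF a(1), of "1 / t"] by auto
  qed
  have bound: "N (T x) \<le> 2 * C" if x: "x \<in> V" "N x \<le> 1" for x
  proof -
    \<comment> \<open>\<open>P k z a\<close> makes \<open>a\<close> an approximant of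
      \<open>z\<close> with controlled image; \<open>R k\<close> is the remainder after
      \<open>k\<close> approximants have been subtracted.\<close>
    define P where "P k z a \<longleftrightarrow> a \<in> V \<and> N (z - a) < (1/2)^Suc k \<and> N (T a) \<le> C * N z" for k z a
    define step where "step k z = z - (SOME a. P k z a)" for k z
    define R where "R = rec_nat x step"
    have R: "R 0 = x" "R (Suc k) = step k (R k)" for k
      by (simp_all add: R_def)
    define A where "A k = R k - R (Suc k)" for k
    have A_eq: "A k = (SOME a. P k (R k) a)" for k
      by (simp add: A_def R step_def)
    have ex: "\<exists>a. P k z a" if "z \<in> V" for k z
      using approx1[OF that, of "(1/2)^Suc k"] unfolding P_def by auto
    have P: "P k z (SOME a. P k z a)" if "z \<in> V" for k z
      using ex[OF that] by (rule someI_ex)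
    have RV: "R k \<in> V" for k
      by (induction k) (use x P V_diff in \<open>auto simp: R step_def P_def\<close>)
    have PA: "P k (R k) (A k)" for k
      using P[OF RV] A_eq by simp
    have AV: "A k \<in> V" for k
      using PA by (simp add: P_def)
    have NR: "N (R k) \<le> (1/2)^k" for k
    proof (cases k)
      case (Suc j)
      then show ?thesis
        using PA[of j] by (simp add: P_def A_def)
    qed (use x in \<open>simp add: R\<close>)
    have sumA: "(\<Sum>i<k. A i) = x - R k" for k
      by (induction k) (simp_all add: A_def R(1))
    have "N (T (A k)) \<le> C * (1/2)^k" for k
      using PA[of k] NR[of k] C mult_left_mono[OF NR[of k] C] by (simp add: P_def)
    then obtain s where s: "s \<in> V" "(\<lambda>k. N ((\<Sum>i<k. T (A i)) - s)) \<longlonglongrightarrow> 0" "N s \<le> 2 * C"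
      using geometric_series[of "\<lambda>k. T (A k)" C] AV T_V by blast
    have "(\<Sum>i<k. T (A i)) = T x - T (R k)" for k
      using T_sum[of "{..<k}" A] AV T_diff[OF x(1) RV[of k]] by (simp add: sumA)
    then have TR: "T (R k) - (T x - s) = - ((\<Sum>i<k. T (A i)) - s)" for k
      by simp
    have sumV: "(\<Sum>i<k. T (A i)) - s \<in> V" for k
      by (intro V_diff V_sum T_V AV s)
    have lim: "(\<lambda>k. N (T (R k) - (T x - s))) \<longlonglongrightarrow> 0"
      unfolding TR N_minus[OF sumV] by (rule s)
    have "(\<lambda>k. (1/2::real)^k) \<longlonglongrightarrow> 0"
      by (rule LIMSEQ_power_zero) simp
    then have "(\<lambda>k. N (R k)) \<longlonglongrightarrow> 0"
      by (rule tendsto_sandwich[OF _ _ tendsto_const, rotated 2]) (simp_all add: NR N_nonneg[OF RV])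
    \<comment> \<open>The remainders tend to 0 while their images tend to \<open>T x - s\<close>, so
      closedness identifies the sum of the images with \<open>T x\<close>.\<close>
    then have "T x - s = 0"
      by (rule T_closed[OF RV V_diff[OF T_V[OF x(1)] s(1)] _ lim])
    then show ?thesis
      using s by simp
  qed
  have "N (T x) \<le> (2 * C) * N x" if x: "x \<in> V" for x
  proof (cases "x = 0")
    case False
    then have pos: "N x > 0"
      using N_nonneg N_eq_0_iff x by (metis less_eq_real_def)
    have "N (T ((1 / N x) *\<^sub>R x)) \<le> 2 * C"
      using pos x by (intro bound V_scaleR) (auto simp: N_scaleR)
    then show ?thesis
      using pos x T_V by (simp add: T_scaleR N_scaleR field_simps)
  qed (simp add: T_zero)
  then show thesis
    using that by blast
qed

end

section \<open>The algebra of bounded operators\<close>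

text \<open>Real parts suffice, since all operators considered are complex linear.\<close>

definition ip :: "'a::complex_hilbert_space \<Rightarrow> 'a \<Rightarrow> real" where
  "ip x y = Re (cinner x y)"

lemma ip_commute: "ip x y = ip y x"
  unfolding ip_def by (subst cinner_commute) simp

lemma ip_add_left: "ip (x + y) z = ip x z + ip y z"
  by (simp add: ip_def cinner_add_left)

lemma ip_scaleR_left: "ip (r *\<^sub>R x) y = r * ip x y"
  by (simp add: ip_def scaleR_scaleC cinner_scaleC_left)

lemma ip_scaleC_left: "ip (scaleC c x) y = ip x (scaleC (cnj c) y)"
proof -
  have "cinner x (scaleC (cnj c) y) = c * cinner x y"
    by (subst (1 2) cinner_commute) (simp add: cinner_scaleC_left)
  then show ?thesis
    by (simp add: ip_def cinner_scaleC_left)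
qed

lemma ip_add_right: "ip z (x + y) = ip z x + ip z y"
  by (simp add: ip_commute[of z] ip_add_left)

lemma ip_scaleR_right: "ip x (r *\<^sub>R y) = r * ip x y"
  by (simp add: ip_commute[of x] ip_scaleR_left)

lemma ip_minus_left: "ip (- x) y = - ip x y"
  using ip_scaleR_left[of "-1" x y] by simp

lemma ip_minus_right: "ip x (- y) = - ip x y"
  using ip_scaleR_right[of x "-1" y] by simp

lemma ip_diff_left: "ip (x - y) z = ip x z - ip y z"
  using ip_add_left[of x "- y" z] by (simp add: ip_minus_left)

lemma ip_diff_right: "ip z (x - y) = ip z x - ip z y"
  using ip_add_right[of z x "- y"] by (simp add: ip_minus_right)

lemma ip_zero [simp]: "ip 0 x = 0" "ip x 0 = 0"
  using ip_scaleR_left[of 0 x x] ip_scaleR_right[of x 0 x] by simp_all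

lemmas ip_simps = ip_add_left ip_add_right ip_scaleR_left ip_scaleR_right
  ip_minus_left ip_minus_right ip_diff_left ip_diff_right

lemma ip_self: "ip x x = (norm x)\<^sup>2"
proof -
  have "0 \<le> ip x x"
    using cinner_self_nonneg[of x] by (auto simp: ip_def complex_nonneg_Reals_iff)
  then show ?thesis
    by (simp add: ip_def norm_eq_sqrt_cinner[of x])
qed

lemma norm_add_sq: "(norm (x + y))\<^sup>2 = (norm x)\<^sup>2 + 2 * ip x y + (norm y)\<^sup>2" for x :: "'a::complex_hilbert_space"
  using ip_commute[of x y] by (simp add: ip_self[symmetric] ip_simps)

lemma norm_diff_sq: "(norm (x - y))\<^sup>2 = (norm x)\<^sup>2 - 2 * ip x y + (norm y)\<^sup>2" for x :: "'a::complex_hilbert_space"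
  using norm_add_sq[of x "- y"] by (simp add: ip_simps)

text \<open>The Cauchy-Schwarz inequality is read off from the triangle inequality, which the class
  already contains through \<open>banach\<close>.\<close>

lemma ip_le_norm: "ip x y \<le> norm x * norm y"
proof -
  have "(norm (x + y))\<^sup>2 \<le> (norm x + norm y)\<^sup>2"
    by (intro power_mono norm_triangle_ineq) simp
  then show ?thesis
    unfolding norm_add_sq by (simp add: power2_sum)
qed

lemma abs_ip_le_norm: "\<bar>ip x y\<bar> \<le> norm x * norm y"
  using ip_le_norm[of x y] ip_le_norm[of "- x" y] by (simp add: ip_simps)

lemma bounded_bilinear_ip: "bounded_bilinear ip"
  by unfold_locales (auto simp: ip_simps abs_ip_le_norm intro!: exI[of _ 1])

lemmas tendsto_ip = bounded_bilinear.tendsto[OF bounded_bilinear_ip]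

lemma norm_scaleC: "norm (scaleC c x) = cmod c * norm x"
proof -
  have "cnj c * c = complex_of_real ((cmod c)\<^sup>2)"
    by (simp only: complex_norm_square mult.commute)
  then have "scaleC (cnj c) (scaleC c x) = (cmod c)\<^sup>2 *\<^sub>R x"
    by (simp only: scaleC_scaleC scaleR_scaleC)
  then have "(norm (scaleC c x))\<^sup>2 = (cmod c * norm x)\<^sup>2"
    by (simp add: ip_self[symmetric] ip_scaleC_left ip_scaleR_right power_mult_distrib)
  then show ?thesis
    by (simp add: power2_eq_iff_nonneg)
qed

lemma bounded_linear_scaleC: "bounded_linear (scaleC c :: 'a \<Rightarrow> 'a::complex_hilbert_space)"
proof
  show "scaleC c (r *\<^sub>R x) = r *\<^sub>R scaleC c x" for r and x :: 'a
    by (simp add: scaleR_scaleC scaleC_scaleC mult.commute)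
  show "\<exists>K. \<forall>x::'a. norm (scaleC c x) \<le> norm x * K"
    by (auto simp: norm_scaleC mult.commute intro!: exI[of _ "cmod c"])
qed (rule scaleC_add_right)

section \<open>The Banach algebra of bounded complex-linear operators\<close>

typedef (overloaded) 'a cop =
  "{f :: 'a::complex_hilbert_space \<Rightarrow>\<^sub>L 'a. \<forall>c x. blinfun_apply f (scaleC c x) = scaleC c (blinfun_apply f x)}"
  morphisms cop_blinfun Cop
  by (rule exI[of _ id_blinfun]) simp

setup_lifting type_definition_cop

lift_definition cop_apply :: "'a::complex_hilbert_space cop \<Rightarrow> 'a \<Rightarrow> 'a" (infixr "\<bullet>\<bullet>" 90)
  is blinfun_apply .

lemma cop_eqI: "(\<And>x. S \<bullet>\<bullet> x = T \<bullet>\<bullet> x) \<Longrightarrow> S = T"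
  by transfer (rule blinfun_eqI)

lemma scaleC_minus_right: "scaleC c (- x) = - scaleC c x"
  using bounded_linear.linear[OF bounded_linear_scaleC, of c] by (rule linear_neg)

lemma scaleC_diff_right: "scaleC c (x - y) = scaleC c x - scaleC c y"
  using bounded_linear.linear[OF bounded_linear_scaleC, of c] by (rule linear_diff)

lemma scaleC_zero_right [simp]: "scaleC c 0 = 0"
  using bounded_linear.linear[OF bounded_linear_scaleC, of c] by (rule linear_0)

lemma scaleC_scaleR: "scaleC c (r *\<^sub>R x) = r *\<^sub>R scaleC c x"
  using bounded_linear.linear[OF bounded_linear_scaleC, of c] by (rule linear_cmul)

text \<open>The class \<open>real_normed_algebra_1\<close> would demand \<open>norm 1 = 1\<close>,
  which fails on the zero space; hence the combination with \<open>monoid_mult\<close>.\<close>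

instantiation cop :: (complex_hilbert_space) "{real_normed_algebra, monoid_mult}"
begin

lift_definition norm_cop :: "'a cop \<Rightarrow> real" is norm .
lift_definition minus_cop :: "'a cop \<Rightarrow> 'a cop \<Rightarrow> 'a cop" is "(-)"
  by (simp add: blinfun.bilinear_simps scaleC_diff_right)
lift_definition uminus_cop :: "'a cop \<Rightarrow> 'a cop" is uminus
  by (simp add: blinfun.bilinear_simps scaleC_minus_right)
lift_definition zero_cop :: "'a cop" is 0
  by simp
lift_definition plus_cop :: "'a cop \<Rightarrow> 'a cop \<Rightarrow> 'a cop" is "(+)"
  by (simp add: blinfun.bilinear_simps scaleC_add_right)
lift_definition scaleR_cop :: "real \<Rightarrow> 'a cop \<Rightarrow> 'a cop" is "scaleR"
  by (simp add: blinfun.bilinear_simps scaleC_scaleR)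
lift_definition times_cop :: "'a cop \<Rightarrow> 'a cop \<Rightarrow> 'a cop" is "(o\<^sub>L)"
  by simp
lift_definition one_cop :: "'a cop" is id_blinfun
  by simp

definition "dist_cop S T = norm (S - T)" for S T :: "'a cop"
definition "sgn_cop S = scaleR (inverse (norm S)) S" for S :: "'a cop"
definition [code del]:
  "(uniformity :: ('a cop \<times> 'a cop) filter) = (INF e\<in>{0 <..}. principal {(x, y). dist x y < e})"
definition [code del]:
  "open_cop U = (\<forall>x\<in>U. \<forall>\<^sub>F (x', y) in uniformity. x' = x \<longrightarrow> y \<in> U)" for U :: "'a cop set"

instance
proof
  fix S T R :: "'a cop" and a b :: real
  show "S * T * R = S * (T * R)"
    by transfer (rule blinfun_eqI, simp)
  show "1 * S = S" "S * 1 = S"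
    by (transfer, rule blinfun_eqI, simp)+
  show "(S + T) * R = S * R + T * R" "S * (T + R) = S * T + S * R"
    by (transfer, rule blinfun_eqI, simp add: blinfun.bilinear_simps)+
  show "a *\<^sub>R S * T = a *\<^sub>R (S * T)" "S * a *\<^sub>R T = a *\<^sub>R (S * T)"
    by (transfer, rule blinfun_eqI, simp add: blinfun.bilinear_simps)+
  show "norm (S * T) \<le> norm S * norm T"
    by transfer (rule norm_blinfun_compose)
  show "norm (S + T) \<le> norm S + norm T"
    by transfer (rule norm_triangle_ineq)
  show "(norm S = 0) = (S = 0)" "norm (a *\<^sub>R S) = \<bar>a\<bar> * norm S"
    by (transfer, simp)+
  show "S + T + R = S + (T + R)" "S + T = T + S" "0 + S = S" "- S + S = 0" "S - T = S + - T"
    by (transfer, simp)+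
  show "a *\<^sub>R (S + T) = a *\<^sub>R S + a *\<^sub>R T" "(a + b) *\<^sub>R S = a *\<^sub>R S + b *\<^sub>R S"
    "a *\<^sub>R b *\<^sub>R S = (a * b) *\<^sub>R S" "1 *\<^sub>R S = S"
    by (transfer, simp add: algebra_simps)+
qed (simp_all add: dist_cop_def sgn_cop_def uniformity_cop_def open_cop_def)

end

lemma cop_apply_simps [simp]:
  "(S + T) \<bullet>\<bullet> x = S \<bullet>\<bullet> x + T \<bullet>\<bullet> x" "(S - T) \<bullet>\<bullet> x = S \<bullet>\<bullet> x - T \<bullet>\<bullet> x" "(- S) \<bullet>\<bullet> x = - (S \<bullet>\<bullet> x)"
  "(S * T) \<bullet>\<bullet> x = S \<bullet>\<bullet> T \<bullet>\<bullet> x" "1 \<bullet>\<bullet> x = x" "0 \<bullet>\<bullet> x = 0" "(r *\<^sub>R S) \<bullet>\<bullet> x = r *\<^sub>R (S \<bullet>\<bullet> x)"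
  by (transfer, simp add: blinfun.bilinear_simps)+

lemma cop_apply_linear:
  "S \<bullet>\<bullet> (x + y) = S \<bullet>\<bullet> x + S \<bullet>\<bullet> y" "S \<bullet>\<bullet> (x - y) = S \<bullet>\<bullet> x - S \<bullet>\<bullet> y" "S \<bullet>\<bullet> (- x) = - (S \<bullet>\<bullet> x)"
  "S \<bullet>\<bullet> 0 = 0" "S \<bullet>\<bullet> (r *\<^sub>R x) = r *\<^sub>R (S \<bullet>\<bullet> x)"
  by (transfer, simp add: blinfun.bilinear_simps)+

lemma cop_apply_scaleC: "S \<bullet>\<bullet> scaleC c x = scaleC c (S \<bullet>\<bullet> x)"
  by transfer simp

lemma norm_cop_apply: "norm (S \<bullet>\<bullet> x) \<le> norm S * norm x"
  by transfer (rule norm_blinfun)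

lemma norm_cop_bound: "0 \<le> b \<Longrightarrow> (\<And>x. norm (S \<bullet>\<bullet> x) \<le> b * norm x) \<Longrightarrow> norm S \<le> b"
  by transfer (rule norm_blinfun_bound)

lemma bounded_bilinear_cop_apply: "bounded_bilinear (\<bullet>\<bullet>)"
  by unfold_locales (auto simp: cop_apply_linear norm_cop_apply intro!: exI[of _ 1])

lemmas tendsto_cop_apply = bounded_bilinear.tendsto[OF bounded_bilinear_cop_apply]

lift_definition cop_scaleC :: "complex \<Rightarrow> 'a::complex_hilbert_space cop \<Rightarrow> 'a cop"
  is "\<lambda>c f. blinfun_compose (Blinfun (scaleC c)) f"
  by (simp add: bounded_linear_Blinfun_apply[OF bounded_linear_scaleC] scaleC_scaleC mult.commute)

lemma cop_scaleC_apply [simp]: "cop_scaleC c S \<bullet>\<bullet> x = scaleC c (S \<bullet>\<bullet> x)"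
  by transfer (simp add: bounded_linear_Blinfun_apply[OF bounded_linear_scaleC])

text \<open>The limit taken among the bounded linear maps is also a pointwise limit, hence commutes
  with \<open>scaleC\<close> and stays in the subtype.\<close>

instance cop :: (complex_hilbert_space) banach
proof
  fix X :: "nat \<Rightarrow> 'a cop" assume X: "Cauchy X"
  have dist: "dist (cop_blinfun S) (cop_blinfun T) = dist S T" for S T :: "'a cop"
    by (simp add: dist_norm norm_cop.rep_eq minus_cop.rep_eq)
  then have "Cauchy (\<lambda>n. cop_blinfun (X n))"
    using X by (simp add: Cauchy_def)
  then obtain f where f: "(\<lambda>n. cop_blinfun (X n)) \<longlonglongrightarrow> f"
    using Cauchy_convergent convergent_def by blast
  have lim: "(\<lambda>n. X n \<bullet>\<bullet> x) \<longlonglongrightarrow> blinfun_apply f x" for x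
    unfolding cop_apply.rep_eq by (intro blinfun.tendsto f tendsto_const)
  have "blinfun_apply f (scaleC c x) = scaleC c (blinfun_apply f x)" for c x
  proof (rule LIMSEQ_unique[OF lim])
    show "(\<lambda>n. X n \<bullet>\<bullet> scaleC c x) \<longlonglongrightarrow> scaleC c (blinfun_apply f x)"
      unfolding cop_apply_scaleC by (rule bounded_linear.tendsto[OF bounded_linear_scaleC lim])
  qed
  then have "cop_blinfun (Cop f) = f"
    by (intro Cop_inverse) simp
  then have "X \<longlonglongrightarrow> Cop f"
    using f by (simp add: tendsto_iff flip: dist)
  then show "convergent X"
    by (rule convergentI)
qed

section \<open>Self-adjoint operators and absolute values\<close>

text \<open>A limit of real polynomials in \<open>a\<close> lies in every such set that contains
  \<open>a\<close>. Taking the algebra at hand yields membership, taking a centralizer yields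
  commutation.\<close>

definition closed_subalgebra :: "'b::{real_normed_algebra, monoid_mult} set \<Rightarrow> bool" where
  "closed_subalgebra A \<longleftrightarrow> closed A \<and> 1 \<in> A \<and>
     (\<forall>x\<in>A. \<forall>y\<in>A. x + y \<in> A \<and> x * y \<in> A) \<and> (\<forall>r. \<forall>x\<in>A. r *\<^sub>R x \<in> A)"

lemma closed_subalgebra_diff:
  "closed_subalgebra A \<Longrightarrow> x \<in> A \<Longrightarrow> y \<in> A \<Longrightarrow> x - y \<in> A"
  unfolding closed_subalgebra_def by (metis scaleR_minus1_left uminus_add_conv_diff add.commute)

lemma closed_subalgebra_centralizer:
  fixes b :: "'b::{real_normed_algebra, monoid_mult}"
  shows "closed_subalgebra {x. x * b = b * x}"
proof -
  have "closed {x. x * b = b * x}"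
    by (intro closed_Collect_eq continuous_intros)
  then show ?thesis
    by (simp add: closed_subalgebra_def distrib_left distrib_right)
      (metis (no_types, lifting) mult.assoc)
qed

text \<open>
  The iteration \<open>y \<mapsto> (x + y\<^sup>2) / 2\<close> converges to \<open>y\<close> with \<open>(1 - y)\<^sup>2 = 1 - x\<close>: its increments are dominated
  by those of the scalar iteration for \<open>x = 1\<close>, which is monotone and bounded by \<open>1\<close>.
\<close>

lemma sqrt_iteration:
  fixes x :: "'b::{real_normed_algebra, monoid_mult, banach}"
  assumes x: "norm x \<le> 1"
  obtains Y y where "Y 0 = 0" "\<And>n. Y (Suc n) = (1/2) *\<^sub>R (x + Y n * Y n)"
    "Y \<longlonglongrightarrow> y" "norm y \<le> 1" "(1 - y) * (1 - y) = 1 - x"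
proof -
  define Y where "Y = rec_nat 0 (\<lambda>_ y. (1/2) *\<^sub>R (x + y * y))"
  define t where "t = rec_nat (0::real) (\<lambda>_ s. (1 + s * s) / 2)"
  have Y: "Y 0 = 0" "Y (Suc n) = (1/2) *\<^sub>R (x + Y n * Y n)" for n
    by (simp_all add: Y_def)
  have t: "t 0 = 0" "t (Suc n) = (1 + t n * t n) / 2" for n
    by (simp_all add: t_def)
  have t01: "0 \<le> t n \<and> t n \<le> 1" for n
  proof (induction n)
    case (Suc n)
    then have "t n * t n \<le> 1"
      by (simp add: mult_le_one)
    then show ?case
      using Suc by (simp add: t)
  qed (simp add: t)
  have comm_x: "Y n * b = b * Y n" if "x * b = b * x" for n b
  proof (induction n)
    case (Suc n)
    have "Y n * Y n * b = b * (Y n * Y n)"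
      by (metis Suc mult.assoc)
    then show ?case
      by (simp add: Y distrib_left distrib_right that)
  qed (simp add: Y)
  \<comment> \<open>First \<open>Y n\<close> commutes with \<open>x\<close>, then \<open>Y m\<close>
    commutes with \<open>Y n\<close>.\<close>
  have comm: "Y m * Y n = Y n * Y m" for m n
    by (rule comm_x, rule comm_x[symmetric]) simp
  have nY: "norm (Y n) \<le> t n" for n
  proof (induction n)
    case (Suc n)
    have "norm (x + Y n * Y n) \<le> 1 + t n * t n"
      using x Suc norm_triangle_ineq[of x "Y n * Y n"] norm_mult_ineq[of "Y n" "Y n"]
        mult_mono[OF Suc Suc] t01[of n] by fastforce
    then show ?case
      by (simp add: Y t)
  qed (simp add: Y t)
  \<comment> \<open>As the iterates commute, a difference of squares factors, and induction bounds
    each increment by the scalar one.\<close>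
  have dY: "norm (Y (Suc n) - Y n) \<le> t (Suc n) - t n" for n
  proof (induction n)
    case (Suc n)
    have "(Y (Suc n) - Y n) * (Y (Suc n) + Y n) = Y (Suc n) * Y (Suc n) - Y n * Y n"
      using comm[of n "Suc n"] by (simp add: algebra_simps)
    then have "Y (Suc (Suc n)) - Y (Suc n) = (1/2) *\<^sub>R ((Y (Suc n) - Y n) * (Y (Suc n) + Y n))"
      by (simp add: Y(2)[of "Suc n"] Y(2)[of n] flip: scaleR_diff_right)
    also have "norm \<dots> \<le> (1/2) * (norm (Y (Suc n) - Y n) * norm (Y (Suc n) + Y n))"
      by (simp add: norm_mult_ineq)
    also have "\<dots> \<le> (1/2) * ((t (Suc n) - t n) * (t (Suc n) + t n))"
    proof -
      have "norm (Y (Suc n) + Y n) \<le> t (Suc n) + t n"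
        using norm_triangle_ineq[of "Y (Suc n)" "Y n"] nY[of n] nY[of "Suc n"] by linarith
      moreover have "0 \<le> t (Suc n) - t n"
        using Suc norm_ge_zero order_trans by blast
      ultimately show ?thesis
        by (intro mult_left_mono mult_mono Suc) auto
    qed
    also have "\<dots> = t (Suc (Suc n)) - t (Suc n)"
      by (simp add: t(2)[of "Suc n"] t(2)[of n] algebra_simps diff_divide_distrib)
    finally show ?case .
  qed (simp add: Y t x)
  \<comment> \<open>The scalar iteration is monotone because its increments dominate norms.\<close>
  have "t n \<le> t (Suc n)" for n
    using dY[of n] norm_ge_zero[of "Y (Suc n) - Y n"] by linarith
  then have "convergent t"
    using t01 by (metis Bseq_mono_convergent incseq_SucI incseqD BseqI' abs_of_nonneg real_norm_def)
  then have "summable (\<lambda>n. t (Suc n) - t n)"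
    using telescope_summable convergent_def by blast
  then have "summable (\<lambda>n. Y (Suc n) - Y n)"
    by (rule summable_comparison_test') (rule dY)
  then have "convergent (\<lambda>n. \<Sum>i<n. Y (Suc i) - Y i)"
    by (simp add: summable_iff_convergent)
  then obtain y where y: "Y \<longlonglongrightarrow> y"
    unfolding sum_lessThan_telescope by (auto simp: Y(1) convergent_def)
  have "(\<lambda>n. (1/2) *\<^sub>R (x + Y n * Y n)) \<longlonglongrightarrow> (1/2) *\<^sub>R (x + y * y)"
    by (intro tendsto_intros y)
  then have "(\<lambda>n. Y (Suc n)) \<longlonglongrightarrow> (1/2) *\<^sub>R (x + y * y)"
    by (simp add: Y)
  then have "y = (1/2) *\<^sub>R (x + y * y)"
    using LIMSEQ_unique LIMSEQ_Suc[OF y] by blast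
  then have "2 *\<^sub>R y = 2 *\<^sub>R ((1/2) *\<^sub>R (x + y * y))"
    by (rule arg_cong)
  then have "x = y + y - y * y"
    by (simp add: scaleR_2)
  then have "(1 - y) * (1 - y) = 1 - x"
    by (simp add: algebra_simps)
  moreover have "norm y \<le> 1"
    using LIMSEQ_le_const2[OF tendsto_norm[OF y], of 1] nY t01 order_trans by blast
  ultimately show thesis
    using that Y y by blast
qed

text \<open>
  A relation rather than an operation: a von Neumann algebra contains the adjoints of its elements by
  definition, so the Riesz representation theorem is not needed.
\<close>

definition is_adj :: "'a::complex_hilbert_space cop \<Rightarrow> 'a cop \<Rightarrow> bool" where
  "is_adj S T \<longleftrightarrow> (\<forall>x y. ip (S \<bullet>\<bullet> x) y = ip x (T \<bullet>\<bullet> y))"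

definition selfadj :: "'a::complex_hilbert_space cop \<Rightarrow> bool" where
  "selfadj S \<longleftrightarrow> is_adj S S"

lemma is_adjD: "is_adj S T \<Longrightarrow> ip (S \<bullet>\<bullet> x) y = ip x (T \<bullet>\<bullet> y)"
  by (simp add: is_adj_def)

lemma selfadjD: "selfadj S \<Longrightarrow> ip (S \<bullet>\<bullet> x) y = ip x (S \<bullet>\<bullet> y)"
  by (simp add: is_adj_def selfadj_def)

lemma is_adj_sym: "is_adj S T \<Longrightarrow> is_adj T S"
  by (simp add: is_adj_def ip_commute)

lemma is_adj_add: "is_adj S S' \<Longrightarrow> is_adj T T' \<Longrightarrow> is_adj (S + T) (S' + T')"
  by (simp add: is_adj_def ip_simps)

lemma is_adj_diff: "is_adj S S' \<Longrightarrow> is_adj T T' \<Longrightarrow> is_adj (S - T) (S' - T')"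
  by (simp add: is_adj_def ip_simps)

lemma is_adj_mult: "is_adj S S' \<Longrightarrow> is_adj T T' \<Longrightarrow> is_adj (S * T) (T' * S')"
  by (simp add: is_adj_def)

lemma is_adj_scaleR: "is_adj S T \<Longrightarrow> is_adj (r *\<^sub>R S) (r *\<^sub>R T)"
  by (simp add: is_adj_def ip_simps)

lemma is_adj_scaleC: "is_adj S T \<Longrightarrow> is_adj (cop_scaleC c S) (cop_scaleC (cnj c) T)"
  by (simp add: is_adj_def ip_scaleC_left cop_apply_scaleC)

lemma selfadj_one: "selfadj 1" and selfadj_zero: "selfadj 0"
  by (simp_all add: is_adj_def selfadj_def)

lemmas selfadj_intros =
  selfadj_one selfadj_zero
  is_adj_add[of S S T T for S T, folded selfadj_def]
  is_adj_diff[of S S T T for S T, folded selfadj_def]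
  is_adj_scaleR[of S S for S, folded selfadj_def]

lemma selfadj_mult: "selfadj S \<Longrightarrow> selfadj T \<Longrightarrow> S * T = T * S \<Longrightarrow> selfadj (S * T)"
  unfolding selfadj_def using is_adj_mult by metis

lemma selfadj_sandwich: "is_adj S S' \<Longrightarrow> selfadj T \<Longrightarrow> selfadj (S * T * S')"
  unfolding selfadj_def using is_adj_mult is_adj_sym by (metis mult.assoc)

text \<open>The squared norm of \<open>S \<bullet>\<bullet> x\<close> is the inner product of
  \<open>x\<close> with \<open>S' \<bullet>\<bullet> S \<bullet>\<bullet> x\<close>.\<close>

lemma is_adj_eq_0: "is_adj S S' \<Longrightarrow> S' * S = 0 \<Longrightarrow> S = 0"
proof (rule cop_eqI)
  fix x assume "is_adj S S'" "S' * S = 0"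
  then have "ip (S \<bullet>\<bullet> x) (S \<bullet>\<bullet> x) = 0"
    by (metis cop_apply_simps(4,6) ip_zero(2) is_adjD)
  then show "S \<bullet>\<bullet> x = 0 \<bullet>\<bullet> x"
    by (simp add: ip_self)
qed

lemma selfadj_sq_eq_0: "selfadj S \<Longrightarrow> S * S = 0 \<Longrightarrow> S = 0"
  unfolding selfadj_def by (rule is_adj_eq_0)

lemma selfadj_limit:
  assumes "\<And>n. selfadj (Y n)" "Y \<longlonglongrightarrow> y"
  shows "selfadj y"
  unfolding selfadj_def is_adj_def
proof (intro allI)
  fix u v
  have "(\<lambda>n. ip (Y n \<bullet>\<bullet> u) v) \<longlonglongrightarrow> ip (y \<bullet>\<bullet> u) v"
    "(\<lambda>n. ip u (Y n \<bullet>\<bullet> v)) \<longlonglongrightarrow> ip u (y \<bullet>\<bullet> v)"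
    by (intro tendsto_ip tendsto_cop_apply tendsto_const assms)+
  then show "ip (y \<bullet>\<bullet> u) v = ip u (y \<bullet>\<bullet> v)"
    using selfadjD[OF assms(1)] LIMSEQ_unique by auto
qed

text \<open>Evaluating the form at \<open>x + S \<bullet>\<bullet> x\<close> leaves the two cross
  terms, which add up to twice the squared norm of \<open>S \<bullet>\<bullet> x\<close>.\<close>

lemma selfadj_form_eq_0:
  assumes S: "selfadj S" and form: "\<And>x. ip (S \<bullet>\<bullet> x) x = 0"
  shows "S = 0"
proof (rule cop_eqI)
  fix x
  have "ip (S \<bullet>\<bullet> (x + S \<bullet>\<bullet> x)) (x + S \<bullet>\<bullet> x) = 2 * ip (S \<bullet>\<bullet> x) (S \<bullet>\<bullet> x)"
    using form[of x] form[of "S \<bullet>\<bullet> x"] selfadjD[OF S, of "S \<bullet>\<bullet> x" x]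
    by (simp add: ip_simps cop_apply_linear)
  then show "S \<bullet>\<bullet> x = 0 \<bullet>\<bullet> x"
    using form by (simp add: ip_self)
qed

lemma norm_cop_apply_le: "norm S \<le> 1 \<Longrightarrow> norm (S \<bullet>\<bullet> x) \<le> norm x"
  using norm_cop_apply[of S x] mult_right_mono[of "norm S" 1 "norm x"] by simp

text \<open>As \<open>b\<close> is a contraction, the cross term in the expansion of the squared
  norm outweighs the last square. The bound makes \<open>sqrt_iteration\<close> applicable to
  \<open>1 - b * b\<close>, and the resulting \<open>1 - y\<close> is the absolute value of
  \<open>b\<close>.\<close>

lemma norm_one_minus_square:
  assumes b: "selfadj b" "norm b \<le> 1"
  shows "norm (1 - b * b) \<le> 1"
proof (rule norm_cop_bound)
  fix x
  have le: "norm (b \<bullet>\<bullet> y) \<le> norm y" for y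
    by (rule norm_cop_apply_le) (rule b)
  have "ip x (b \<bullet>\<bullet> b \<bullet>\<bullet> x) = (norm (b \<bullet>\<bullet> x))\<^sup>2"
    using selfadjD[OF b(1), of x "b \<bullet>\<bullet> x"] by (simp add: ip_self)
  then have "(norm ((1 - b * b) \<bullet>\<bullet> x))\<^sup>2
      = (norm x)\<^sup>2 - 2 * (norm (b \<bullet>\<bullet> x))\<^sup>2 + (norm (b \<bullet>\<bullet> b \<bullet>\<bullet> x))\<^sup>2"
    by (simp add: norm_diff_sq)
  also have "\<dots> \<le> (norm x)\<^sup>2"
    using power_mono[OF le[of "b \<bullet>\<bullet> x"] norm_ge_zero, of 2] zero_le_power2[of "norm (b \<bullet>\<bullet> x)"] by linarith
  finally have "norm ((1 - b * b) \<bullet>\<bullet> x) \<le> norm x"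
    by (rule power2_le_imp_le) simp
  then show "norm ((1 - b * b) \<bullet>\<bullet> x) \<le> 1 * norm x"
    by simp
qed simp

text \<open>Up to scaling, \<open>w\<close> is \<open>1 - y\<close> with \<open>y\<close> from the
  square root iteration, and \<open>norm y \<le> 1\<close> makes it positive. The last clause
  reflects that \<open>w\<close> is a limit of polynomials in \<open>a\<close>.\<close>

lemma absolute_value:
  assumes a: "selfadj a"
  obtains w where "selfadj w" "w * w = a * a" "\<And>x. 0 \<le> ip (w \<bullet>\<bullet> x) x"
    "\<And>A. closed_subalgebra A \<Longrightarrow> a \<in> A \<Longrightarrow> w \<in> A"
proof (cases "a = 0")
  case True
  then show thesis
    using that[of 0] by (simp add: selfadj_zero)
next
  case False
  define b where "b = (1 / norm a) *\<^sub>R a"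
  have b: "selfadj b" "norm b \<le> 1" "norm a *\<^sub>R b = a"
    using False a by (simp_all add: b_def selfadj_intros)
  obtain Y y where Y: "Y 0 = 0" "\<And>n. Y (Suc n) = (1/2) *\<^sub>R (1 - b * b + Y n * Y n)"
    "Y \<longlonglongrightarrow> y" "norm y \<le> 1" "(1 - y) * (1 - y) = 1 - (1 - b * b)"
    using sqrt_iteration[OF norm_one_minus_square[OF b(1,2)]] by metis
  have "selfadj (Y n)" for n
    by (induction n) (simp_all add: Y selfadj_intros selfadj_mult b)
  then have y: "selfadj y"
    using Y(3) selfadj_limit by blast
  define w where "w = norm a *\<^sub>R (1 - y)"
  show thesis
  proof (rule that[of w])
    show "selfadj w"
      by (simp add: w_def selfadj_intros y)
    have "w * w = (norm a *\<^sub>R b) * (norm a *\<^sub>R b)"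
      using Y(5) by (simp add: w_def)
    then show "w * w = a * a"
      by (simp only: b(3))
    show "0 \<le> ip (w \<bullet>\<bullet> x) x" for x
    proof -
      have "ip (y \<bullet>\<bullet> x) x \<le> norm (y \<bullet>\<bullet> x) * norm x"
        by (rule ip_le_norm)
      also have "\<dots> \<le> norm x * norm x"
        by (intro mult_right_mono norm_cop_apply_le Y) simp
      finally have "ip (y \<bullet>\<bullet> x) x \<le> ip x x"
        by (simp add: ip_self power2_eq_square)
      then show ?thesis
        by (simp add: w_def ip_simps)
    qed
    show "w \<in> A" if A: "closed_subalgebra A" "a \<in> A" for A
    proof -
      have "1 - b * b \<in> A"
        using A closed_subalgebra_diff[OF A(1)] by (simp add: closed_subalgebra_def b_def)
      moreover have "0 \<in> A"
        using A unfolding closed_subalgebra_def by (metis scaleR_zero_left)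
      ultimately have "Y n \<in> A" for n
        by (induction n) (use A(1) in \<open>simp_all add: Y closed_subalgebra_def\<close>)
      then have "y \<in> A"
        using A(1) Y(3) closed_sequentially unfolding closed_subalgebra_def by blast
      then show ?thesis
        using A closed_subalgebra_diff[OF A(1)] by (simp add: closed_subalgebra_def w_def)
    qed
  qed
qed

section \<open>The separating space of a derivation\<close>

lemma is_adj_zero: "is_adj 0 T \<Longrightarrow> T = 0"
  using is_adj_eq_0[of T 0] is_adj_sym[of 0 T] by simp

lemma norm_one_cop: "norm (1 :: 'a::complex_hilbert_space cop) \<le> 1"
  by (rule norm_cop_bound) simp_all

lemma cop_scaleC_simps:
  "cop_scaleC c (S + T) = cop_scaleC c S + cop_scaleC c T"
  "cop_scaleC c S * T = cop_scaleC c (S * T)"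
  "S * cop_scaleC c T = cop_scaleC c (S * T)"
  "cop_scaleC c (cop_scaleC d S) = cop_scaleC (c * d) S"
  "cop_scaleC (complex_of_real r) S = r *\<^sub>R S"
  "cop_scaleC (c + d) S = cop_scaleC c S + cop_scaleC d S"
  by (rule cop_eqI, simp add: scaleC_add_right scaleC_add_left scaleC_scaleC cop_apply_scaleC
      flip: scaleR_scaleC)+

text \<open>The setting in terms of operators instead of graphs. Norm closedness of \<open>M\<close>
  puts the absolute values of its self-adjoint elements into \<open>M\<close>.\<close>

locale ideal_derivation = banach_on E N
  for E :: "'a::complex_hilbert_space cop set" and N :: "'a cop \<Rightarrow> real" +
  fixes M :: "'a cop set" and D :: "'a cop \<Rightarrow> 'a cop"
  assumes M_closed: "closed_subalgebra M"
    and M_scaleC: "\<And>c x. x \<in> M \<Longrightarrow> cop_scaleC c x \<in> M"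
    and M_adj: "\<And>x. x \<in> M \<Longrightarrow> \<exists>x'\<in>M. is_adj x x'"
    and E_M: "E \<subseteq> M"
    and E_left: "\<And>u x. u \<in> M \<Longrightarrow> x \<in> E \<Longrightarrow> u * x \<in> E"
    and E_right: "\<And>u x. u \<in> M \<Longrightarrow> x \<in> E \<Longrightarrow> x * u \<in> E"
    and N_scaleC: "\<And>c x. x \<in> E \<Longrightarrow> N (cop_scaleC c x) = cmod c * N x"
    and N_sandwich: "\<And>u x v. u \<in> M \<Longrightarrow> x \<in> E \<Longrightarrow> v \<in> M \<Longrightarrow>
          N (u * x * v) \<le> norm u * norm v * N x"
    and D_E: "\<And>x. x \<in> E \<Longrightarrow> D x \<in> E"
    and D_add: "\<And>x y. x \<in> E \<Longrightarrow> y \<in> E \<Longrightarrow> D (x + y) = D x + D y"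
    and D_scaleC: "\<And>c x. x \<in> E \<Longrightarrow> D (cop_scaleC c x) = cop_scaleC c (D x)"
    and D_mult: "\<And>x y. x \<in> E \<Longrightarrow> y \<in> E \<Longrightarrow> D (x * y) = D x * y + x * D y"
begin

lemma EM: "x \<in> E \<Longrightarrow> x \<in> M"
  using E_M by blast

lemma M_one: "1 \<in> M"
  and M_add: "x \<in> M \<Longrightarrow> y \<in> M \<Longrightarrow> x + y \<in> M"
  and M_mult: "x \<in> M \<Longrightarrow> y \<in> M \<Longrightarrow> x * y \<in> M"
  and M_scaleR: "x \<in> M \<Longrightarrow> r *\<^sub>R x \<in> M"
  using M_closed by (simp_all add: closed_subalgebra_def)

lemma M_diff: "x \<in> M \<Longrightarrow> y \<in> M \<Longrightarrow> x - y \<in> M"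
  using M_closed by (rule closed_subalgebra_diff)

lemma D_scaleR: "x \<in> E \<Longrightarrow> D (r *\<^sub>R x) = r *\<^sub>R D x"
  using D_scaleC[of x "complex_of_real r"] by (simp add: cop_scaleC_simps)

lemma N_left:
  assumes "u \<in> M" "x \<in> E"
  shows "N (u * x) \<le> norm u * N x"
proof -
  have "N (u * x * 1) \<le> norm u * norm (1 :: 'a cop) * N x"
    by (intro N_sandwich assms M_one)
  also have "\<dots> \<le> norm u * 1 * N x"
    by (intro mult_right_mono mult_left_mono norm_one_cop N_nonneg assms) simp
  finally show ?thesis
    by simp
qed

lemma N_right:
  assumes "u \<in> M" "x \<in> E"
  shows "N (x * u) \<le> norm u * N x"
proof -
  have "N (1 * x * u) \<le> norm (1 :: 'a cop) * norm u * N x"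
    by (intro N_sandwich assms M_one)
  also have "\<dots> \<le> 1 * norm u * N x"
    by (intro mult_right_mono norm_one_cop N_nonneg assms) simp
  finally show ?thesis
    by simp
qed

lemma N_null_comparison:
  assumes "\<And>n. X n \<in> E" "\<And>n. N (X n) \<le> f n" "f \<longlonglongrightarrow> 0"
  shows "(\<lambda>n. N (X n)) \<longlonglongrightarrow> 0"
  by (rule tendsto_sandwich[OF _ _ tendsto_const assms(3)]) (simp_all add: assms N_nonneg)

section \<open>The separating space and its stability under multiplication by the ideal\<close>

definition Sep :: "'a cop set" where
  "Sep = {y \<in> E. \<exists>X. (\<forall>n::nat. X n \<in> E) \<and> (\<lambda>n. N (X n)) \<longlonglongrightarrow> 0 \<and> (\<lambda>n. N (D (X n) - y)) \<longlonglongrightarrow> 0}"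

lemma SepE:
  assumes "y \<in> Sep"
  obtains X where "y \<in> E" "\<And>n::nat. X n \<in> E" "(\<lambda>n. N (X n)) \<longlonglongrightarrow> 0" "(\<lambda>n. N (D (X n) - y)) \<longlonglongrightarrow> 0"
  using assms by (auto simp: Sep_def)

lemma Sep_E: "y \<in> Sep \<Longrightarrow> y \<in> E"
  by (simp add: Sep_def)

text \<open>The Leibniz rule splits the error into \<open>D a * X n\<close> and
  \<open>a * (D (X n) - y)\<close>. As it involves \<open>D a\<close>, the multiplier is taken from
  \<open>E\<close>.\<close>

lemma left_limit:
  assumes a: "a \<in> E" and X: "\<And>n::nat. X n \<in> E" "y \<in> E"
    and lim: "(\<lambda>n. N (X n)) \<longlonglongrightarrow> 0" "(\<lambda>n. N (D (X n) - y)) \<longlonglongrightarrow> 0"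
  shows "(\<lambda>n. N (D (a * X n) - a * y)) \<longlonglongrightarrow> 0"
proof (rule N_null_comparison)
  show "D (a * X n) - a * y \<in> E" for n
    by (intro V_diff D_E E_left EM a X)
  have eq: "D (a * X n) - a * y = D a * X n + a * (D (X n) - y)" for n
    by (simp add: D_mult[OF a X(1)] algebra_simps)
  show "N (D (a * X n) - a * y) \<le> norm (D a) * N (X n) + norm a * N (D (X n) - y)" for n
    unfolding eq
    by (rule order_trans[OF N_triangle]) (intro add_mono N_left E_left V_diff D_E EM a X)+
  have "(\<lambda>n. norm (D a) * N (X n) + norm a * N (D (X n) - y)) \<longlonglongrightarrow> norm (D a) * 0 + norm a * 0"
    by (intro tendsto_intros lim)
  then show "(\<lambda>n. norm (D a) * N (X n) + norm a * N (D (X n) - y)) \<longlonglongrightarrow> 0"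
    by simp
qed

lemma right_limit:
  assumes a: "a \<in> E" and X: "\<And>n::nat. X n \<in> E" "y \<in> E"
    and lim: "(\<lambda>n. N (X n)) \<longlonglongrightarrow> 0" "(\<lambda>n. N (D (X n) - y)) \<longlonglongrightarrow> 0"
  shows "(\<lambda>n. N (D (X n * a) - y * a)) \<longlonglongrightarrow> 0"
proof (rule N_null_comparison)
  show "D (X n * a) - y * a \<in> E" for n
    by (intro V_diff D_E E_left EM a X)
  have eq: "D (X n * a) - y * a = (D (X n) - y) * a + X n * D a" for n
    by (simp add: D_mult[OF X(1) a] algebra_simps)
  show "N (D (X n * a) - y * a) \<le> norm a * N (D (X n) - y) + norm (D a) * N (X n)" for n
    unfolding eq
    by (rule order_trans[OF N_triangle]) (intro add_mono N_right E_right V_diff D_E EM a X)+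
  have "(\<lambda>n. norm a * N (D (X n) - y) + norm (D a) * N (X n)) \<longlonglongrightarrow> norm a * 0 + norm (D a) * 0"
    by (intro tendsto_intros lim)
  then show "(\<lambda>n. norm a * N (D (X n) - y) + norm (D a) * N (X n)) \<longlonglongrightarrow> 0"
    by simp
qed

lemma N_left_null:
  assumes "u \<in> M" "\<And>n::nat. X n \<in> E" "(\<lambda>n. N (X n)) \<longlonglongrightarrow> 0"
  shows "(\<lambda>n. N (u * X n)) \<longlonglongrightarrow> 0"
  by (rule N_null_comparison[of _ "\<lambda>n. norm u * N (X n)"])
    (use assms in \<open>auto intro: E_left N_left tendsto_mult_right_zero\<close>)

lemma N_right_null:
  assumes "u \<in> M" "\<And>n::nat. X n \<in> E" "(\<lambda>n. N (X n)) \<longlonglongrightarrow> 0"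
  shows "(\<lambda>n. N (X n * u)) \<longlonglongrightarrow> 0"
  by (rule N_null_comparison[of _ "\<lambda>n. norm u * N (X n)"])
    (use assms in \<open>auto intro: E_right N_right tendsto_mult_right_zero\<close>)

lemma Sep_left: "a \<in> E \<Longrightarrow> y \<in> Sep \<Longrightarrow> a * y \<in> Sep"
proof (erule SepE)
  fix X assume a: "a \<in> E" "y \<in> E" "\<And>n::nat. X n \<in> E" "(\<lambda>n. N (X n)) \<longlonglongrightarrow> 0"
    "(\<lambda>n. N (D (X n) - y)) \<longlonglongrightarrow> 0"
  show "a * y \<in> Sep"
    unfolding Sep_def
    using left_limit[OF a(1,3,2,4,5)] N_left_null[OF EM[OF a(1)] a(3,4)] a
    by (auto intro!: E_left EM exI[of _ "\<lambda>n. a * X n"])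
qed

lemma Sep_right: "a \<in> E \<Longrightarrow> y \<in> Sep \<Longrightarrow> y * a \<in> Sep"
proof (erule SepE)
  fix X assume a: "a \<in> E" "y \<in> E" "\<And>n::nat. X n \<in> E" "(\<lambda>n. N (X n)) \<longlonglongrightarrow> 0"
    "(\<lambda>n. N (D (X n) - y)) \<longlonglongrightarrow> 0"
  show "y * a \<in> Sep"
    unfolding Sep_def
    using right_limit[OF a(1,3,2,4,5)] N_right_null[OF EM[OF a(1)] a(3,4)] a
    by (auto intro!: E_right EM exI[of _ "\<lambda>n. X n * a"])
qed

lemma Sep_scaleR: "y \<in> Sep \<Longrightarrow> r *\<^sub>R y \<in> Sep"
proof (erule SepE)
  fix X assume a: "y \<in> E" "\<And>n::nat. X n \<in> E" "(\<lambda>n. N (X n)) \<longlonglongrightarrow> 0"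
    "(\<lambda>n. N (D (X n) - y)) \<longlonglongrightarrow> 0"
  have "D (r *\<^sub>R X n) - r *\<^sub>R y = r *\<^sub>R (D (X n) - y)" for n
    by (simp add: D_scaleR a algebra_simps)
  then have "N (D (r *\<^sub>R X n) - r *\<^sub>R y) = \<bar>r\<bar> * N (D (X n) - y)" for n
    using N_scaleR V_diff D_E a by metis
  moreover have "N (r *\<^sub>R X n) = \<bar>r\<bar> * N (X n)" for n
    by (simp add: N_scaleR a)
  ultimately show "r *\<^sub>R y \<in> Sep"
    unfolding Sep_def using a
    by (auto intro!: V_scaleR exI[of _ "\<lambda>n. r *\<^sub>R X n"] tendsto_mult_right_zero)
qed

text \<open>Along a separating sequence, \<open>h * X n\<close> tends to 0 but
  \<open>D (f * X n)\<close> tends to \<open>f * y \<noteq> 0\<close>; a suitable multiple of a late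
  term satisfies both inequalities.\<close>

lemma separating_blow_up:
  assumes f: "f \<in> E" and y: "y \<in> Sep" "f * y \<noteq> 0" and h: "h \<in> M" and \<epsilon>: "\<epsilon> > 0"
  shows "\<exists>x\<in>E. N (h * x) \<le> \<epsilon> \<and> R < N (D (f * x))"
proof -
  obtain X where X: "y \<in> E" "\<And>n::nat. X n \<in> E" "(\<lambda>n. N (X n)) \<longlonglongrightarrow> 0"
    "(\<lambda>n. N (D (X n) - y)) \<longlonglongrightarrow> 0"
    using SepE[OF y(1)] by metis
  define \<rho> where "\<rho> = N (f * y)"
  have fy: "f * y \<in> E"
    by (intro E_left EM f X)
  then have \<rho>: "\<rho> > 0"
    using N_nonneg[of "f * y"] N_eq_0_iff[of "f * y"] y(2) by (simp add: \<rho>_def)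
  \<comment> \<open>The factor is such that \<open>t * (\<rho> / 2) = \<bar>R\<bar> + 1\<close>,
    which exceeds \<open>R\<close>.\<close>
  define t where "t = 2 * (\<bar>R\<bar> + 1) / \<rho>"
  have t: "t > 0"
    using \<rho> by (simp add: t_def add_pos_nonneg)
  have "\<forall>\<^sub>F n in sequentially. N (D (f * X n) - f * y) < \<rho> / 2"
    by (rule order_tendstoD(2)[OF left_limit[OF f X(2,1,3,4)]]) (use \<rho> in simp)
  moreover have "\<forall>\<^sub>F n in sequentially. N (h * X n) < \<epsilon> / t"
    by (rule order_tendstoD(2)[OF N_left_null[OF h X(2,3)]]) (use \<epsilon> t in simp)
  ultimately have "\<forall>\<^sub>F n in sequentially. N (D (f * X n) - f * y) < \<rho> / 2 \<and> N (h * X n) < \<epsilon> / t"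
    by (rule eventually_conj)
  then obtain n where n: "N (D (f * X n) - f * y) < \<rho> / 2" "N (h * X n) < \<epsilon> / t"
    using eventually_happens trivial_limit_sequentially by blast
  have DE: "D (f * X n) \<in> E"
    by (intro D_E E_left EM f X)
  have "\<rho> / 2 < N (D (f * X n))"
    using N_le_diff[OF fy DE] N_minus_commute[OF fy DE] n(1) by (simp add: \<rho>_def)
  then have "t * (\<rho> / 2) < t * N (D (f * X n))"
    using t by simp
  moreover have "t * (\<rho> / 2) = \<bar>R\<bar> + 1"
    using \<rho> by (simp add: t_def)
  ultimately have "R < t * N (D (f * X n))"
    by linarith
  moreover have "N (D (f * t *\<^sub>R X n)) = t * N (D (f * X n))"
    using t by (simp add: D_scaleR N_scaleR D_E E_left EM f X)
  moreover have "N (h * t *\<^sub>R X n) = t * N (h * X n)"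
    using t by (simp add: N_scaleR E_left h X)
  ultimately show ?thesis
    using n(2) t by (intro bexI[of _ "t *\<^sub>R X n"] V_scaleR X) (simp add: pos_less_divide_eq mult.commute)
qed

text \<open>
  A gliding hump. With \<open>k\<^sub>n = h\<^sub>n y\<^sub>n\<close>, the elements \<open>g\<^sub>n = k\<^sub>n\<^sup>* k\<^sub>n k\<^sub>n\<^sup>*\<close> of the ideal satisfy \<open>g\<^sub>n h\<^sub>m = 0\<close> for
  \<open>m \<noteq> n\<close>. Choosing \<open>x\<^sub>n\<close> by the previous lemma, the sum \<open>c\<close> of the \<open>h\<^sub>n x\<^sub>n\<close> has \<open>g\<^sub>n c = g\<^sub>n h\<^sub>n x\<^sub>n\<close>, so
  that the Leibniz rule bounds \<open>\<delta>(g\<^sub>n h\<^sub>n x\<^sub>n)\<close> in terms of \<open>c\<close>.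
\<close>

lemma no_orthogonal_sequence:
  fixes h y :: "nat \<Rightarrow> 'a cop"
  assumes h: "\<And>n. h n \<in> M" "\<And>n. selfadj (h n)" "\<And>m n. m \<noteq> n \<Longrightarrow> h m * h n = 0"
    and y: "\<And>n. y n \<in> Sep" "\<And>n. h n * y n \<noteq> 0"
  shows False
proof -
  define k where "k n = h n * y n" for n
  have kE: "k n \<in> E" for n
    unfolding k_def by (intro E_left h Sep_E y)
  have "\<forall>n. \<exists>k'\<in>M. is_adj (k n) k'"
    using M_adj EM kE by blast
  then obtain k' where k': "\<And>n. k' n \<in> M" "\<And>n. is_adj (k n) (k' n)"
    by metis
  define g where "g n = k' n * k n * k' n" for n
  define f where "f n = g n * h n" for n
  have gE: "g n \<in> E" for n
    unfolding g_def by (intro E_left E_right k' kE)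
  have fE: "f n \<in> E" for n
    unfolding f_def by (intro E_right gE h)
  \<comment> \<open>Taking adjoints in \<open>h m * k n = 0\<close> gives
    \<open>k' n * h m = 0\<close>, and \<open>g n\<close> ends in \<open>k' n\<close>.\<close>
  have gh: "g n * h m = 0" if "m \<noteq> n" for m n
  proof -
    have "h m * k n = 0"
      using h(3)[OF that] by (simp add: k_def flip: mult.assoc)
    then have "k' n * h m = 0"
      using is_adj_mult[OF h(2)[of m, unfolded selfadj_def] k'(2)[of n]] is_adj_zero by simp
    then show ?thesis
      by (simp add: g_def mult.assoc)
  qed
  \<comment> \<open>Here \<open>f n * y n\<close> is the square of the self-adjoint
    \<open>k' n * k n\<close>, which explains the shape of \<open>g n\<close>.\<close>
  have fy: "f n * y n \<noteq> 0" for n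
  proof
    assume "f n * y n = 0"
    then have "k' n * k n * (k' n * k n) = 0"
      by (simp add: f_def g_def k_def mult.assoc)
    moreover have "selfadj (k' n * k n)"
      unfolding selfadj_def by (intro is_adj_mult k' is_adj_sym)
    ultimately have "k' n * k n = 0"
      using selfadj_sq_eq_0 by blast
    then show False
      using is_adj_eq_0[OF k'(2)] y(2) by (auto simp: k_def)
  qed
  \<comment> \<open>With this constant, \<open>N (D (g n * c)) \<le> A n * (N c + N (D c))\<close>
    for every \<open>c\<close> in \<open>E\<close>; the factor \<open>real n\<close> below
    eventually beats the bracket.\<close>
  define A where "A n = norm (D (g n)) + norm (g n)" for n
  have "\<forall>n. \<exists>x\<in>E. N (h n * x) \<le> (1/2)^n \<and> real n * A n < N (D (f n * x))"
    by (intro allI separating_blow_up[OF fE y(1) fy h(1)]) simp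
  then obtain x where x: "\<And>n. x n \<in> E" "\<And>n. N (h n * x n) \<le> (1/2)^n"
    "\<And>n. real n * A n < N (D (f n * x n))"
    by metis
  obtain c where c: "c \<in> E" "(\<lambda>n. N ((\<Sum>i<n. h i * x i) - c)) \<longlonglongrightarrow> 0"
  proof (rule geometric_series[of "\<lambda>n. h n * x n" 1])
    show "h n * x n \<in> E" "N (h n * x n) \<le> 1 * (1/2)^n" for n
      using x h by (simp_all add: E_left)
  qed
  have gc: "g n * c = f n * x n" for n
  proof -
    \<comment> \<open>From index \<open>Suc n\<close> on, the partial sums contain the term with
      index \<open>n\<close>, the only one that survives multiplication by
      \<open>g n\<close>.\<close>
    have le: "N (f n * x n - g n * c) \<le> norm (g n) * N ((\<Sum>i<m. h i * x i) - c)" if "m \<ge> Suc n" for m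
    proof -
      have "(\<Sum>i<m. g n * (h i * x i)) = (\<Sum>i<m. if i = n then f n * x n else 0)"
        by (rule sum.cong) (auto simp: f_def gh simp flip: mult.assoc)
      also have "\<dots> = f n * x n"
        using that by simp
      finally have "f n * x n - g n * c = g n * ((\<Sum>i<m. h i * x i) - c)"
        by (simp add: right_diff_distrib sum_distrib_left)
      then show ?thesis
        using N_left[OF EM[OF gE]] by (simp add: V_diff V_sum E_left h x c)
    qed
    have "(\<lambda>m. norm (g n) * N ((\<Sum>i<m. h i * x i) - c)) \<longlonglongrightarrow> 0"
      by (intro tendsto_mult_right_zero c)
    then have "N (f n * x n - g n * c) \<le> 0"
      using le by (intro LIMSEQ_le_const) auto
    moreover have "f n * x n - g n * c \<in> E"
      by (intro V_diff E_left EM fE gE x c)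
    ultimately show ?thesis
      using N_nonneg N_eq_0_iff by (metis order_antisym right_minus_eq)
  qed
  obtain n where n: "N c + N (D c) \<le> real n"
    using real_arch_simple by blast
  have "N (D (f n * x n)) = N (D (g n) * c + g n * D c)"
    by (simp add: D_mult gE c flip: gc)
  also have "\<dots> \<le> norm (D (g n)) * N c + norm (g n) * N (D c)"
    by (rule order_trans[OF N_triangle]) (intro add_mono N_left E_left D_E EM gE c)+
  also have "\<dots> \<le> A n * (N c + N (D c))"
    using N_nonneg[OF c(1)] N_nonneg[OF D_E[OF c(1)]] by (simp add: A_def algebra_simps)
  also have "\<dots> \<le> A n * real n"
    using n by (intro mult_left_mono) (auto simp: A_def)
  finally show False
    using x(3)[of n] by (simp add: mult.commute)
qed

section \<open>Indecomposable corners and a minimal projection\<close>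

definition charged :: "'a cop \<Rightarrow> bool" where
  "charged h \<longleftrightarrow> h \<in> M \<and> selfadj h \<and> (\<exists>y\<in>Sep. h * y \<noteq> 0)"

text \<open>Here \<open>k\<close> need not be a projection: the pieces split off by positive and
  negative parts are only self-adjoint.\<close>

definition corner :: "'a cop \<Rightarrow> 'a cop set" where
  "corner k = {k * x * k | x. x \<in> M}"

definition indecomposable :: "'a cop \<Rightarrow> bool" where
  "indecomposable k \<longleftrightarrow> charged k \<and>
     (\<forall>u\<in>corner k. \<forall>v\<in>corner k. u * v = 0 \<longrightarrow> \<not> (charged u \<and> charged v))"

text \<open>If every charged element splits, one piece is set aside and the other is split again;
  the pieces set aside form a sequence excluded by \<open>no_orthogonal_sequence\<close>.\<close>

lemma indecomposable_exists:
  assumes "y \<in> Sep" "y \<noteq> 0"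
  shows "\<exists>k. indecomposable k"
proof (rule ccontr)
  assume "\<not> ?thesis"
  then have "\<forall>k. \<exists>u v. charged k \<longrightarrow> u \<in> corner k \<and> v \<in> corner k \<and> u * v = 0 \<and> charged u \<and> charged v"
    unfolding indecomposable_def by blast
  then obtain F G where FG: "\<And>k. charged k \<Longrightarrow> F k \<in> corner k \<and> G k \<in> corner k \<and>
      F k * G k = 0 \<and> charged (F k) \<and> charged (G k)"
    by metis
  \<comment> \<open>\<open>K n\<close> is the part still to be split, and \<open>h n\<close> is the
    piece set aside from it.\<close>
  define K where "K n = (G ^^ n) 1" for n
  define h where "h n = F (K n)" for n
  have K_Suc: "K (Suc n) = G (K n)" for n
    by (simp add: K_def)
  have charged_one: "charged 1"
    using assms by (auto simp: charged_def M_one selfadj_one)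
  have K: "charged (K n)" for n
  proof (induction n)
    case (Suc n)
    then show ?case
      using FG[of "K n"] by (simp add: K_Suc)
  qed (simp add: K_def charged_one)
  have h: "h n \<in> M" "selfadj (h n)" "\<exists>y\<in>Sep. h n * y \<noteq> 0" for n
    using FG[OF K[of n]] by (auto simp: h_def charged_def)
  \<comment> \<open>Corners are nested, so a later remainder has every earlier one as a left factor;
    \<open>h n\<close> annihilates \<open>K (Suc n)\<close> and thus all later pieces.\<close>
  have factor: "\<exists>z. K m = K n * z" if "n \<le> m" for m n
    using that
  proof (induction m rule: dec_induct)
    case base
    show ?case
      by (rule exI[of _ 1]) simp
  next
    case (step m)
    then obtain z where "K m = K n * z"
      by blast
    moreover obtain x where "K (Suc m) = K m * x * K m"
      using FG[OF K[of m]] by (auto simp: K_Suc corner_def)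
    ultimately have "K (Suc m) = K n * (z * x * K m)"
      by (simp add: mult.assoc)
    then show ?case
      by blast
  qed
  have lt: "h n * h m = 0" if nm: "n < m" for m n
  proof -
    obtain z where "K m = K (Suc n) * z"
      using factor[of "Suc n" m] nm by auto
    moreover obtain x where "h m = K m * x * K m"
      using FG[OF K[of m]] by (auto simp: h_def corner_def)
    ultimately have "h n * h m = h n * K (Suc n) * (z * x * K m)"
      by (simp add: mult.assoc)
    also have "h n * K (Suc n) = 0"
      using FG[OF K[of n]] by (simp add: h_def K_Suc)
    finally show ?thesis
      by simp
  qed
  have "h m * h n = 0" if "m \<noteq> n" for m n
  proof (cases "m < n")
    case False
    then have "h n * h m = 0"
      using lt that by simp
    then show ?thesis
      using is_adj_mult[OF h(2)[of n, unfolded selfadj_def] h(2)[of m, unfolded selfadj_def]]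
        is_adj_zero by simp
  qed (rule lt)
  moreover obtain y where "\<And>n. y n \<in> Sep" "\<And>n. h n * y n \<noteq> 0"
    using h(3) by metis
  ultimately show False
    using no_orthogonal_sequence[of h y] h by blast
qed

text \<open>For each real \<open>c\<close> the compressed positive and negative parts of
  \<open>g - c *\<^sub>R 1\<close> are orthogonal elements of the corner, so one of them annihilates
  \<open>z\<close>. Hence the form of \<open>g\<close> on the range of \<open>z * z\<close> lies on
  one side of \<open>c\<close> times the squared norm, and a Dedekind cut finds the scalar.\<close>

lemma scalar_compression:
  assumes indec: "indecomposable k"
    and z: "z \<in> Sep" "z \<in> corner k" "selfadj z"
    and g: "g \<in> M" "selfadj g" "g * z = z * g"
  obtains c :: real where "z * z * (g - c *\<^sub>R 1) * (z * z) = 0"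
proof (cases "z = 0")
  case True
  then show thesis
    using that by simp
next
  case False
  then obtain \<xi>0 where \<xi>0: "(z * z) \<bullet>\<bullet> \<xi>0 \<noteq> 0"
    using selfadj_sq_eq_0[OF z(3)] cop_eqI[of "z * z" 0] by fastforce
  have zM: "z \<in> M"
    using z(1) Sep_E EM by blast
  have k: "k \<in> M"
    using indec by (simp add: indecomposable_def charged_def)
  \<comment> \<open>The form of \<open>z * z * b * (z * z)\<close> at \<open>\<xi>\<close> is that
    of \<open>b\<close> at \<open>\<eta> \<xi>\<close>, so only these vectors matter.\<close>
  define \<eta> where "\<eta> \<xi> = (z * z) \<bullet>\<bullet> \<xi>" for \<xi>
  define r where "r \<xi> = ip (g \<bullet>\<bullet> \<eta> \<xi>) (\<eta> \<xi>)" for \<xi>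
  have form: "ip ((z * z * b * (z * z)) \<bullet>\<bullet> \<xi>) \<xi> = ip (b \<bullet>\<bullet> \<eta> \<xi>) (\<eta> \<xi>)" for b \<xi>
    using selfadjD[OF z(3)] by (simp add: \<eta>_def)
  have dichotomy: "(\<forall>\<xi>. r \<xi> \<le> c * (norm (\<eta> \<xi>))\<^sup>2) \<or> (\<forall>\<xi>. c * (norm (\<eta> \<xi>))\<^sup>2 \<le> r \<xi>)" for c
  proof -
    define a where "a = g - c *\<^sub>R 1"
    have a: "a \<in> M" "selfadj a" "a * z = z * a"
      using g by (simp_all add: a_def M_diff M_scaleR M_one selfadj_intros algebra_simps)
    obtain w where w: "selfadj w" "w * w = a * a" "\<And>x. 0 \<le> ip (w \<bullet>\<bullet> x) x"
      "\<And>A. closed_subalgebra A \<Longrightarrow> a \<in> A \<Longrightarrow> w \<in> A"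
      using absolute_value[OF a(2)] by metis
    have wM: "w \<in> M"
      using w(4)[OF M_closed a(1)] .
    have wz: "w * z = z * w"
      using w(4)[OF closed_subalgebra_centralizer[of z]] a(3) by simp
    have wa: "w * a = a * w"
      using w(4)[OF closed_subalgebra_centralizer[of a]] by simp
    \<comment> \<open>With \<open>w\<close> the absolute value of \<open>a\<close>,
      \<open>w + a\<close> is twice the positive and \<open>w - a\<close> twice the negative part of
      \<open>a\<close>; their product vanishes since \<open>w\<close> commutes with \<open>a\<close>
      and \<open>w * w = a * a\<close>.\<close>
    define u where "u = z * (w + a) * z"
    define v where "v = z * (w - a) * z"
    have u_eq: "u = z * z * (w + a)"
      unfolding u_def using wz a(3) by (simp add: algebra_simps)
    have v_eq: "v = (w - a) * z * z"
      unfolding v_def using wz a(3) by (simp add: algebra_simps)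
    have v_eq': "v = z * z * (w - a)"
      unfolding v_def using wz a(3) by (simp add: algebra_simps)
    have "(w + a) * (w - a) = 0"
      using w(2) wa by (simp add: algebra_simps)
    then have "z * z * ((w + a) * (w - a)) * z * z = 0"
      by simp
    then have uv: "u * v = 0"
      by (simp add: u_eq v_eq mult.assoc)
    obtain x where x: "x \<in> M" "z = k * x * k"
      using z(2) by (auto simp: corner_def)
    have corner: "z * b * z \<in> corner k" if "b \<in> M" for b
    proof -
      have "z * b * z = k * (x * k * b * k * x) * k"
        by (simp add: x mult.assoc)
      then show ?thesis
        using that x k M_mult by (auto simp: corner_def)
    qed
    have uM: "u \<in> M" "selfadj u" and vM: "v \<in> M" "selfadj v"
      using selfadj_sandwich[OF z(3)[unfolded selfadj_def]] a w wM zM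
      by (simp_all add: u_def v_def M_mult M_add M_diff selfadj_intros)
    have "u \<in> corner k" "v \<in> corner k"
      unfolding u_def v_def by (intro corner M_add M_diff wM a)+
    \<comment> \<open>One of the pieces is not charged, so it annihilates all of \<open>Sep\<close>,
      in particular \<open>z\<close>.\<close>
    then have "u * z = 0 \<or> v * z = 0"
      using indec uv uM vM z(1) unfolding indecomposable_def charged_def by blast
    then show ?thesis
    proof
      assume "u * z = 0"
      then have "z * z * (w + a) * (z * z) = 0"
        by (metis u_eq mult.assoc mult_zero_left)
      then have "ip ((w + a) \<bullet>\<bullet> \<eta> \<xi>) (\<eta> \<xi>) = 0" for \<xi>
        using form[of "w + a" \<xi>] by simp
      then have "ip (w \<bullet>\<bullet> \<eta> \<xi>) (\<eta> \<xi>) + (r \<xi> - c * (norm (\<eta> \<xi>))\<^sup>2) = 0" for \<xi>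
        by (simp add: r_def a_def ip_simps ip_self)
      then have "r \<xi> \<le> c * (norm (\<eta> \<xi>))\<^sup>2" for \<xi>
        using w(3)[of "\<eta> \<xi>"] by (smt (verit))
      then show ?thesis
        by blast
    next
      assume "v * z = 0"
      then have "z * z * (w - a) * (z * z) = 0"
        by (metis v_eq' mult.assoc mult_zero_left)
      then have "ip ((w - a) \<bullet>\<bullet> \<eta> \<xi>) (\<eta> \<xi>) = 0" for \<xi>
        using form[of "w - a" \<xi>] by simp
      then have "c * (norm (\<eta> \<xi>))\<^sup>2 \<le> r \<xi>" for \<xi>
        using w(3)[of "\<eta> \<xi>"] by (simp add: r_def a_def ip_simps ip_self)
      then show ?thesis
        by blast
    qed
  qed
  \<comment> \<open>\<open>A\<close> collects the lower bounds of the form relative to the squared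
    norm, and its supremum will be the scalar. The nonzero vector \<open>\<eta> \<xi>0\<close>
    bounds \<open>A\<close> from above.\<close>
  define A where "A = {c. \<forall>\<xi>. c * (norm (\<eta> \<xi>))\<^sup>2 \<le> r \<xi>}"
  have pos: "(norm (\<eta> \<xi>0))\<^sup>2 > 0"
    using \<xi>0 by (simp add: \<eta>_def)
  have "- norm g \<in> A"
    unfolding A_def
  proof (intro CollectI allI)
    fix \<xi>
    have "- r \<xi> \<le> norm (g \<bullet>\<bullet> \<eta> \<xi>) * norm (\<eta> \<xi>)"
      using abs_ip_le_norm[of "g \<bullet>\<bullet> \<eta> \<xi>" "\<eta> \<xi>"] by (simp add: r_def)
    also have "\<dots> \<le> (norm g * norm (\<eta> \<xi>)) * norm (\<eta> \<xi>)"
      by (intro mult_right_mono norm_cop_apply) simp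
    finally show "- norm g * (norm (\<eta> \<xi>))\<^sup>2 \<le> r \<xi>"
      by (simp add: power2_eq_square mult.assoc)
  qed
  moreover have bdd: "bdd_above A"
    using pos by (intro bdd_aboveI[of _ "r \<xi>0 / (norm (\<eta> \<xi>0))\<^sup>2"]) (simp add: A_def pos_le_divide_eq)
  moreover from \<open>- norm g \<in> A\<close> have "A \<noteq> {}"
    by blast
  ultimately have ge: "Sup A * (norm (\<eta> \<xi>))\<^sup>2 \<le> r \<xi>" for \<xi>
  proof (cases "\<eta> \<xi> = 0")
    case False
    then have "(norm (\<eta> \<xi>))\<^sup>2 > 0"
      by simp
    moreover from this have "Sup A \<le> r \<xi> / (norm (\<eta> \<xi>))\<^sup>2"
      using \<open>A \<noteq> {}\<close> by (intro cSup_least) (auto simp: A_def pos_le_divide_eq)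
    ultimately show ?thesis
      by (simp add: pos_le_divide_eq)
  qed (simp add: r_def)
  have le: "r \<xi> \<le> Sup A * (norm (\<eta> \<xi>))\<^sup>2" for \<xi>
  proof (rule ccontr)
    assume "\<not> ?thesis"
    then have lt: "Sup A * (norm (\<eta> \<xi>))\<^sup>2 < r \<xi>"
      by simp
    then have n: "(norm (\<eta> \<xi>))\<^sup>2 > 0"
      by (auto simp: r_def)
    then have "Sup A < r \<xi> / (norm (\<eta> \<xi>))\<^sup>2"
      using lt by (simp add: pos_less_divide_eq)
    \<comment> \<open>A number strictly in between is no lower bound, so by the dichotomy it is an
      upper bound, contrary to its choice.\<close>
    then obtain c where c: "Sup A < c" "c < r \<xi> / (norm (\<eta> \<xi>))\<^sup>2"
      using dense by blast
    then have "c \<notin> A"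
      using cSup_upper[OF _ bdd] by fastforce
    then have "r \<xi> \<le> c * (norm (\<eta> \<xi>))\<^sup>2"
      using dichotomy[of c] by (auto simp: A_def)
    then show False
      using c(2) n by (simp add: pos_less_divide_eq)
  qed
  have "z * z * (g - Sup A *\<^sub>R 1) * (z * z) = 0"
  proof (rule selfadj_form_eq_0)
    have "is_adj (z * z) (z * z)"
      using z(3) is_adj_mult by (auto simp: selfadj_def)
    then show "selfadj (z * z * (g - Sup A *\<^sub>R 1) * (z * z))"
      by (rule selfadj_sandwich) (simp add: selfadj_intros g)
    show "ip ((z * z * (g - Sup A *\<^sub>R 1) * (z * z)) \<bullet>\<bullet> \<xi>) \<xi> = 0" for \<xi>
      unfolding form using ge[of \<xi>] le[of \<xi>] by (simp add: r_def ip_simps ip_self)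
  qed
  then show thesis
    by (rule that)
qed

text \<open>A nonzero self-adjoint \<open>z\<close> in \<open>Sep\<close> and in an indecomposable
  corner is a scalar under compression by itself, which forces \<open>z * z = c *\<^sub>R z\<close>;
  dividing by \<open>c\<close> gives \<open>e\<close>. Compressions by \<open>e\<close> are then
  scalar by the same lemma.\<close>

lemma minimal_projection:
  assumes "y \<in> Sep" "y \<noteq> 0"
  obtains e where "e \<in> Sep" "e \<noteq> 0" "e * e = e" "\<And>x. x \<in> M \<Longrightarrow> \<exists>c. e * x * e = cop_scaleC c e"
proof -
  obtain k where indec: "indecomposable k"
    using indecomposable_exists assms by blast
  then obtain s where k: "k \<in> M" "selfadj k" and s: "s \<in> Sep" "k * s \<noteq> 0"
    by (auto simp: indecomposable_def charged_def)
  obtain s' where s': "s' \<in> M" "is_adj s s'"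
    using M_adj s Sep_E EM by blast
  define \<kappa> where "\<kappa> = k * s"
  define \<kappa>' where "\<kappa>' = s' * k"
  define q where "q = \<kappa> * \<kappa>'"
  \<comment> \<open>In the fourth power of \<open>q\<close> some factor \<open>s\<close> stands
    between two elements of \<open>E\<close>, so that \<open>z\<close> lies in \<open>Sep\<close>;
    as a square of a square it is nonzero.\<close>
  define z where "z = q * q * (q * q)"
  have sM: "s \<in> M"
    using s Sep_E EM by blast
  have adj: "is_adj \<kappa> \<kappa>'"
    unfolding \<kappa>_def \<kappa>'_def using is_adj_mult s' k(2) by (auto simp: selfadj_def)
  have q: "selfadj q"
    unfolding selfadj_def q_def by (intro is_adj_mult adj is_adj_sym[OF adj])
  have z: "selfadj z"
    unfolding z_def by (intro selfadj_mult q) simp_all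
  have "\<kappa>' \<noteq> 0"
    using adj is_adj_zero is_adj_sym s(2) by (metis \<kappa>_def)
  then have "q \<noteq> 0"
    using is_adj_eq_0[OF is_adj_sym[OF adj]] by (auto simp: q_def)
  then have "z \<noteq> 0"
    unfolding z_def using selfadj_sq_eq_0 q selfadj_mult by blast
  have \<kappa>E: "\<kappa> \<in> E" "\<kappa>' \<in> M"
    unfolding \<kappa>_def \<kappa>'_def by (intro E_left M_mult k s' Sep_E s)+
  have "z = (\<kappa> * \<kappa>' * \<kappa> * \<kappa>' * k) * s * (\<kappa>' * \<kappa> * \<kappa>')"
    by (simp add: z_def q_def \<kappa>_def mult.assoc)
  moreover have "\<kappa> * \<kappa>' * \<kappa> * \<kappa>' * k \<in> E" "\<kappa>' * \<kappa> * \<kappa>' \<in> E"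
    by (intro E_right E_left \<kappa>E k EM[OF \<kappa>E(1)])+
  ultimately have zS: "z \<in> Sep"
    using Sep_left Sep_right s(1) by metis
  have zM: "z \<in> M"
    using zS Sep_E EM by blast
  have "z = k * (s * s' * k * k * s * s' * k * k * s * s' * k * k * s * s') * k"
    by (simp add: z_def q_def \<kappa>_def \<kappa>'_def mult.assoc)
  moreover have "s * s' * k * k * s * s' * k * k * s * s' * k * k * s * s' \<in> M"
    by (intro M_mult sM s' k)
  ultimately have zc: "z \<in> corner k"
    unfolding corner_def by blast
  \<comment> \<open>Here \<open>z\<close> is both the compressing and the compressed
    element.\<close>
  obtain c where c: "z * z * (z - c *\<^sub>R 1) * (z * z) = 0"
    using scalar_compression[OF indec zS zc z zM z] by blast
  define X where "X = z - c *\<^sub>R 1"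
  have zX: "z * X = X * z"
    by (simp add: X_def algebra_simps)
  \<comment> \<open>By commutation, the fourth power of \<open>z * X\<close> contains the vanishing
    factor \<open>z * z * X * (z * z)\<close>, and a self-adjoint element with vanishing fourth
    power is 0.\<close>
  have "selfadj (z * X)"
    by (intro selfadj_mult z zX) (simp add: X_def selfadj_intros z)
  moreover have "z * X * (z * X) = X * (z * z * X)" "z * X * (z * X) = z * z * X * X"
    by (metis zX mult.assoc)+
  from arg_cong2[OF this, of "(*)"]
  have "z * X * (z * X) * (z * X * (z * X)) = X * (z * z * X * (z * z)) * X * X"
    by (simp only: mult.assoc)
  then have "z * X * (z * X) * (z * X * (z * X)) = 0"
    by (simp add: c[folded X_def])
  ultimately have "z * X = 0"
    using selfadj_sq_eq_0 selfadj_mult by blast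
  then have zz: "z * z = c *\<^sub>R z"
    by (simp add: X_def algebra_simps)
  have "c \<noteq> 0"
    using zz selfadj_sq_eq_0[OF z] \<open>z \<noteq> 0\<close> by auto
  define e where "e = (1 / c) *\<^sub>R z"
  have e: "e \<noteq> 0" "e * e = e" "selfadj e" "e \<in> Sep"
    using \<open>c \<noteq> 0\<close> \<open>z \<noteq> 0\<close> zz z by (simp_all add: e_def selfadj_intros Sep_scaleR zS)
  have eM: "e \<in> M"
    using e(4) Sep_E EM by blast
  obtain t where "t \<in> M" "z = k * t * k"
    using zc by (auto simp: corner_def)
  then have "e = k * ((1 / c) *\<^sub>R t) * k" "(1 / c) *\<^sub>R t \<in> M"
    by (simp_all add: e_def M_scaleR)
  then have ec: "e \<in> corner k"
    unfolding corner_def by blast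
  have real: "\<exists>r. e * x * e = r *\<^sub>R e" if x: "x \<in> M" "selfadj x" for x
  proof -
    \<comment> \<open>Multiplication by \<open>e\<close> does not change \<open>e * x * e\<close>,
      so this element commutes with \<open>e\<close> and is its own compression.\<close>
    have "e * x * e * e = e * x * e" "e * (e * x * e) = e * x * e"
      using e(2) by (metis mult.assoc)+
    moreover obtain r where "e * e * (e * x * e - r *\<^sub>R 1) * (e * e) = 0"
    proof (rule scalar_compression[OF indec e(4) ec e(3)])
      show "e * x * e \<in> M"
        by (intro M_mult eM x)
      show "selfadj (e * x * e)"
        using e(3) x(2) by (intro selfadj_sandwich) (simp_all add: selfadj_def)
      show "e * x * e * e = e * (e * x * e)"
        using calculation by simp
    qed
    ultimately have "e * x * e = r *\<^sub>R e"
      by (simp add: e(2) algebra_simps)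
    then show ?thesis ..
  qed
  have "\<exists>c. e * x * e = cop_scaleC c e" if x: "x \<in> M" for x
  proof -
    obtain x' where x': "x' \<in> M" "is_adj x x'"
      using M_adj x by blast
    \<comment> \<open>The real and imaginary parts of \<open>x\<close> reduce the claim to
      self-adjoint elements.\<close>
    define x1 where "x1 = (1/2) *\<^sub>R (x + x')"
    define x2 where "x2 = cop_scaleC (- \<i> / 2) (x - x')"
    have "x1 \<in> M" "x2 \<in> M"
      unfolding x1_def x2_def by (intro M_scaleR M_scaleC M_add M_diff x x')+
    have "is_adj x1 ((1/2) *\<^sub>R (x' + x))"
      unfolding x1_def by (intro is_adj_scaleR is_adj_add x' is_adj_sym[OF x'(2)])
    then have "selfadj x1"
      by (simp add: selfadj_def x1_def add.commute)
    have "is_adj x2 (cop_scaleC (cnj (- \<i> / 2)) (x' - x))"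
      unfolding x2_def by (intro is_adj_scaleC is_adj_diff x' is_adj_sym[OF x'(2)])
    moreover have "cop_scaleC (cnj (- \<i> / 2)) (x' - x) = x2"
    proof -
      have "x' - x = cop_scaleC (-1) (x - x')"
        using cop_scaleC_simps(5)[of "-1" "x - x'"] by simp
      then show ?thesis
        by (simp add: x2_def cop_scaleC_simps(4))
    qed
    ultimately have "selfadj x2"
      by (simp add: selfadj_def)
    obtain r1 r2 where r: "e * x1 * e = r1 *\<^sub>R e" "e * x2 * e = r2 *\<^sub>R e"
      using real \<open>x1 \<in> M\<close> \<open>selfadj x1\<close> \<open>x2 \<in> M\<close> \<open>selfadj x2\<close> by blast
    have "cop_scaleC \<i> x2 = (1/2) *\<^sub>R (x - x')"
      using cop_scaleC_simps(5)[of "1/2" "x - x'"] by (simp add: x2_def cop_scaleC_simps(4))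
    then have "x1 + cop_scaleC \<i> x2 = (1/2) *\<^sub>R (x + x)"
      by (simp add: x1_def flip: scaleR_add_right)
    then have "x = x1 + cop_scaleC \<i> x2"
      by (simp flip: scaleR_2)
    then have "e * x * e = e * x1 * e + cop_scaleC \<i> (e * x2 * e)"
      by (simp add: distrib_left distrib_right cop_scaleC_simps(2,3))
    also have "\<dots> = cop_scaleC (complex_of_real r1 + \<i> * complex_of_real r2) e"
      by (simp only: r cop_scaleC_simps(4-6) flip: cop_scaleC_simps(5))
    finally show ?thesis ..
  qed
  then show thesis
    using that e by blast
qed

text \<open>\<open>D\<close> is continuous on the line spanned by \<open>e\<close>, which makes
  \<open>D (e * X n * e)\<close> tend to 0. By the Leibniz rule \<open>e * D (X n) * e\<close> then
  tends to 0 as well, although its limit is \<open>e * e * e = e\<close>.\<close>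

lemma Sep_trivial:
  assumes "y \<in> Sep"
  shows "y = 0"
proof (rule ccontr)
  assume "y \<noteq> 0"
  then obtain e where e: "e \<in> Sep" "e \<noteq> 0" "e * e = e" "\<And>x. x \<in> M \<Longrightarrow> \<exists>c. e * x * e = cop_scaleC c e"
    using minimal_projection assms by metis
  obtain X where X: "e \<in> E" "\<And>n::nat. X n \<in> E" "(\<lambda>n. N (X n)) \<longlonglongrightarrow> 0"
    "(\<lambda>n. N (D (X n) - e)) \<longlonglongrightarrow> 0"
    using SepE[OF e(1)] by metis
  have eM: "e \<in> M"
    using X(1) EM by blast
  have Ne: "N e > 0"
    using N_nonneg[OF X(1)] N_eq_0_iff[OF X(1)] e(2) by simp
  \<comment> \<open>\<open>\<alpha>\<close> adds the constants for \<open>D (e * X n * e)\<close>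
    and for the two outer Leibniz terms.\<close>
  define \<alpha> where "\<alpha> = norm e * norm e / N e * N (D e) + 2 * (norm (D e) * norm e)"
  have bound: "N e \<le> \<alpha> * N (X n) + norm e * norm e * N (D (X n) - e)" for n
  proof -
    let ?x = "X n"
    obtain c where c: "e * ?x * e = cop_scaleC c e"
      using e(4) EM X(2) by metis
    have "cmod c * N e = N (e * ?x * e)"
      by (simp add: c N_scaleC X)
    also have "\<dots> \<le> norm e * norm e * N ?x"
      by (intro N_sandwich eM X)
    finally have cle: "cmod c \<le> norm e * norm e / N e * N ?x"
      using Ne by (simp add: field_simps)
    have exE: "e * ?x \<in> E"
      by (intro E_left eM X)
    have "D (e * ?x * e) = D e * ?x * e + e * D ?x * e + e * ?x * D e"
      by (simp add: D_mult[OF exE X(1)] D_mult[OF X(1) X(2)] distrib_right)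
    then have eq: "cop_scaleC c (D e) = D e * ?x * e + e * D ?x * e + e * ?x * D e"
      by (simp add: c D_scaleC X)
    have "e * e * e = e"
      by (simp add: e(3))
    \<comment> \<open>\<open>e\<close> is the middle Leibniz term \<open>e * D (X n) * e\<close>
      minus its deviation \<open>e * (D (X n) - e) * e\<close>.\<close>
    then have dec: "e = (cop_scaleC c (D e) - D e * ?x * e - e * ?x * D e) - e * (D ?x - e) * e"
      unfolding eq by (simp add: algebra_simps)
    have scE: "cop_scaleC c (D e) \<in> E"
      unfolding eq by (intro V_add E_left E_right D_E eM EM X)
    have mem: "D e * ?x * e \<in> E" "e * ?x * D e \<in> E" "e * (D ?x - e) * e \<in> E"
      by (intro E_left E_right V_diff D_E eM EM X)+
    have "N e \<le> N (cop_scaleC c (D e)) + N (D e * ?x * e) + N (e * ?x * D e) + N (e * (D ?x - e) * e)"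
      using N_diff_le[OF V_diff[OF V_diff[OF scE mem(1)] mem(2)] mem(3)]
        N_diff_le[OF V_diff[OF scE mem(1)] mem(2)] N_diff_le[OF scE mem(1)]
      by (simp flip: dec)
    also have "\<dots> \<le> norm e * norm e / N e * N ?x * N (D e) + norm (D e) * norm e * N ?x
        + norm e * norm (D e) * N ?x + norm e * norm e * N (D ?x - e)"
    proof (intro add_mono N_sandwich)
      show "N (cop_scaleC c (D e)) \<le> norm e * norm e / N e * N ?x * N (D e)"
        unfolding N_scaleC[OF D_E[OF X(1)]]
        by (intro mult_right_mono cle N_nonneg D_E X)
    qed (intro eM EM V_diff D_E X)+
    also have "\<dots> = \<alpha> * N ?x + norm e * norm e * N (D ?x - e)"
      by (simp add: \<alpha>_def algebra_simps)
    finally show ?thesis .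
  qed
  have "(\<lambda>n. \<alpha> * N (X n) + norm e * norm e * N (D (X n) - e)) \<longlonglongrightarrow> \<alpha> * 0 + norm e * norm e * 0"
    by (intro tendsto_intros X)
  then have "N e \<le> \<alpha> * 0 + norm e * norm e * 0"
    by (rule LIMSEQ_le_const) (use bound in blast)
  then show False
    using Ne by simp
qed

theorem derivation_bounded:
  obtains K where "\<And>x. x \<in> E \<Longrightarrow> N (D x) \<le> K * N x"
proof (rule closed_graph[of D])
  show "y = 0" if "\<And>n. X n \<in> E" "y \<in> E" "(\<lambda>n. N (X n)) \<longlonglongrightarrow> 0" "(\<lambda>n. N (D (X n) - y)) \<longlonglongrightarrow> 0" for X y
    using that by (intro Sep_trivial) (auto simp: Sep_def)
qed (use D_E D_add D_scaleR in auto)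

end

section \<open>Operators as graphs\<close>

definition cop_graph :: "'a::complex_hilbert_space cop \<Rightarrow> 'a lop" where
  "cop_graph T = range (\<lambda>\<xi>. (\<xi>, T \<bullet>\<bullet> \<xi>))"

lemma in_cop_graph: "(\<xi>, \<eta>) \<in> cop_graph T \<longleftrightarrow> \<eta> = T \<bullet>\<bullet> \<xi>"
  by (auto simp: cop_graph_def)

lemma cop_graph_eq_iff: "cop_graph S = cop_graph T \<longleftrightarrow> S = T"
  using cop_eqI[of S T] in_cop_graph by metis

lemma bounded_ops_eq: "bounded_ops = range cop_graph"
proof (intro subset_antisym subsetI)
  fix x :: "'a lop" assume "x \<in> bounded_ops"
  then obtain f where f: "x = range (\<lambda>\<xi>. (\<xi>, f \<xi>))" "bounded_linear f"
    "\<And>c \<xi>. f (scaleC c \<xi>) = scaleC c (f \<xi>)"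
    unfolding bounded_ops_def by blast
  then have "Cop (Blinfun f) \<bullet>\<bullet> \<xi> = f \<xi>" for \<xi>
    by (simp add: cop_apply.rep_eq Cop_inverse bounded_linear_Blinfun_apply)
  then have "x = cop_graph (Cop (Blinfun f))"
    by (simp add: f(1) cop_graph_def)
  then show "x \<in> range cop_graph"
    by blast
next
  fix x :: "'a lop" assume "x \<in> range cop_graph"
  then obtain T where T: "x = cop_graph T"
    by blast
  have "bounded_linear (\<lambda>\<xi>. T \<bullet>\<bullet> \<xi>)"
    by (rule bounded_bilinear.bounded_linear_right[OF bounded_bilinear_cop_apply])
  then show "x \<in> bounded_ops"
    unfolding bounded_ops_def T cop_graph_def using cop_apply_scaleC by blast
qed

text \<open>This removes the closures from the strong operations on bounded operators.\<close>

lemma closed_cop_graph: "closed (cop_graph T)"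
proof -
  have "continuous_on UNIV (\<lambda>p::'a \<times> 'a. T \<bullet>\<bullet> fst p)"
    by (intro bounded_linear.continuous_on[OF
          bounded_bilinear.bounded_linear_right[OF bounded_bilinear_cop_apply]] continuous_intros)
  then have "closed {p. snd p = T \<bullet>\<bullet> fst p}"
    by (intro closed_Collect_eq continuous_intros)
  also have "{p. snd p = T \<bullet>\<bullet> fst p} = cop_graph T"
    by (auto simp: in_cop_graph)
  finally show ?thesis .
qed

lemma op_zero_eq: "op_zero = cop_graph 0"
  by (auto simp: op_zero_def in_cop_graph)

lemma op_add_cop_graph: "op_add (cop_graph S) (cop_graph T) = cop_graph (S + T)"
  by (auto simp: op_add_def in_cop_graph)

lemma op_scale_cop_graph: "op_scale c (cop_graph T) = cop_graph (cop_scaleC c T)"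
  by (auto simp: op_scale_def in_cop_graph)

lemma op_mult_cop_graph: "op_mult (cop_graph S) (cop_graph T) = cop_graph (S * T)"
  by (auto simp: op_mult_def in_cop_graph)

lemma strong_add_cop_graph: "strong_add (cop_graph S) (cop_graph T) = cop_graph (S + T)"
  by (simp add: strong_add_def op_add_cop_graph closed_cop_graph)

lemma strong_scale_cop_graph: "strong_scale c (cop_graph T) = cop_graph (cop_scaleC c T)"
  by (simp add: strong_scale_def op_scale_cop_graph closed_cop_graph)

lemma strong_mult_cop_graph: "strong_mult (cop_graph S) (cop_graph T) = cop_graph (S * T)"
  by (simp add: strong_mult_def op_mult_cop_graph closed_cop_graph)

lemma strong_diff_cop_graph: "strong_diff (cop_graph S) (cop_graph T) = cop_graph (S - T)"
  using cop_scaleC_simps(5)[of "-1" T]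
  by (simp add: strong_diff_def strong_scale_cop_graph strong_add_cop_graph)

lemma op_norm_cop_graph: "op_norm (cop_graph T) = norm T"
proof -
  have "op_apply (cop_graph T) = (\<lambda>\<xi>. T \<bullet>\<bullet> \<xi>)"
    by (intro ext) (simp add: op_apply_def in_cop_graph)
  then show ?thesis
    by (simp add: op_norm_def norm_cop.rep_eq norm_blinfun.rep_eq cop_apply.rep_eq)
qed

lemma op_adj_cop_graph: "op_adj (cop_graph S) = cop_graph T \<Longrightarrow> is_adj S T"
  unfolding is_adj_def
proof (intro allI)
  fix x y assume "op_adj (cop_graph S) = cop_graph T"
  then have "(y, T \<bullet>\<bullet> y) \<in> op_adj (cop_graph S)"
    by (simp add: in_cop_graph)
  then have "cinner (S \<bullet>\<bullet> x) y = cinner x (T \<bullet>\<bullet> y)"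
    by (auto simp: op_adj_def in_cop_graph)
  then show "ip (S \<bullet>\<bullet> x) y = ip x (T \<bullet>\<bullet> y)"
    by (simp add: ip_def)
qed

lemmas cop_graph_simps = op_zero_eq op_mult_cop_graph op_add_cop_graph op_scale_cop_graph
  strong_add_cop_graph strong_scale_cop_graph
  strong_mult_cop_graph strong_diff_cop_graph op_norm_cop_graph cop_graph_eq_iff

lemma cop_graph_in_commutant:
  assumes "C \<subseteq> bounded_ops"
  shows "cop_graph T \<in> commutant C \<longleftrightarrow> (\<forall>S. cop_graph S \<in> C \<longrightarrow> S * T = T * S)"
proof -
  have "cop_graph T \<in> commutant C \<longleftrightarrow>
      (\<forall>x\<in>C. op_mult x (cop_graph T) = op_mult (cop_graph T) x)"
    by (simp add: commutant_def bounded_ops_eq)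
  also have "\<dots> \<longleftrightarrow> (\<forall>S. cop_graph S \<in> C \<longrightarrow> S * T = T * S)"
    using assms unfolding bounded_ops_eq by (force simp: cop_graph_simps)
  finally show ?thesis .
qed

text \<open>The bicommutant property exhibits the algebra as an intersection of centralizers, each
  of which is a closed subalgebra.\<close>

lemma von_neumann_algebra_cop:
  assumes "von_neumann_algebra M"
  defines "M' \<equiv> {T. cop_graph T \<in> M}"
  shows "closed_subalgebra M'" "T \<in> M' \<Longrightarrow> cop_scaleC c T \<in> M'"
    "T \<in> M' \<Longrightarrow> \<exists>T'\<in>M'. is_adj T T'"
proof -
  define C where "C = {S. cop_graph S \<in> commutant M}"
  have M: "M \<subseteq> bounded_ops" "\<And>x. x \<in> M \<Longrightarrow> op_adj x \<in> M" "commutant (commutant M) = M"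
    using assms(1) by (simp_all add: von_neumann_algebra_def)
  have "commutant M \<subseteq> bounded_ops"
    by (auto simp: commutant_def)
  then have in_M': "T \<in> M' \<longleftrightarrow> (\<forall>S\<in>C. S * T = T * S)" for T
    using cop_graph_in_commutant[of "commutant M" T] by (simp add: M'_def C_def M(3))
  then have M'_eq: "M' = (\<Inter>S\<in>C. {T. T * S = S * T})"
    by (auto simp: eq_commute)
  have sub: "closed_subalgebra {T. T * S = S * T}" for S :: "'a cop"
    by (rule closed_subalgebra_centralizer)
  then show "closed_subalgebra M'"
    unfolding M'_eq closed_subalgebra_def by (auto intro!: closed_INT)
  show "cop_scaleC c T \<in> M'" if "T \<in> M'"
    using that by (simp add: in_M' cop_scaleC_simps)
  show "\<exists>T'\<in>M'. is_adj T T'" if "T \<in> M'"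
  proof -
    have "op_adj (cop_graph T) \<in> M"
      using that M(2) by (simp add: M'_def)
    then obtain T' where "op_adj (cop_graph T) = cop_graph T'" "cop_graph T' \<in> M"
      using M(1) by (auto simp: bounded_ops_eq)
    then show ?thesis
      using op_adj_cop_graph by (auto simp: M'_def)
  qed
qed

theorem theorem8:
  fixes M E :: "'a::complex_hilbert_space lop set"
    and \<tau> :: "'a lop \<Rightarrow> ennreal"
    and N :: "'a lop \<Rightarrow> real"
    and \<delta> :: "'a lop \<Rightarrow> 'a lop"
  assumes "semifinite_von_neumann_algebra M"
    and "fns_trace M \<tau>"
    and "two_sided_ideal M E"
    and "E \<subseteq> M \<inter> tau_compact M \<tau>"
    and "banach_bimodule M \<tau> E N"
    and "derivation E E \<delta>"
  shows "norm_continuous_on E N \<delta>"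
proof -
  define M' where "M' = {T. cop_graph T \<in> M}"
  define E' where "E' = {T. cop_graph T \<in> E}"
  define N' where "N' T = N (cop_graph T)" for T
  \<comment> \<open>As \<open>\<delta>\<close> maps \<open>E\<close> into \<open>E\<close> and
    \<open>E\<close> consists of graphs of bounded operators, the choice has a witness for every
    \<open>T\<close> in \<open>E'\<close>, unique since \<open>cop_graph\<close> is
    injective.\<close>
  define D where "D T = (SOME S. cop_graph S = \<delta> (cop_graph T))" for T
  have vN: "von_neumann_algebra M"
    using assms(1) by (simp add: semifinite_von_neumann_algebra_def)
  have M_ops: "M \<subseteq> range cop_graph"
    using vN by (simp add: von_neumann_algebra_def bounded_ops_eq)
  have EM: "E \<subseteq> M"
    using assms(4) by blast
  have E_ops: "\<exists>T. x = cop_graph T" if "x \<in> E" for x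
    using that EM M_ops by blast
  have \<delta>E: "\<delta> x \<in> E" if "x \<in> E" for x
    using assms(6) that by (simp add: derivation_def)
  have D: "cop_graph (D T) = \<delta> (cop_graph T)" if "T \<in> E'" for T
  proof -
    have "\<exists>S. cop_graph S = \<delta> (cop_graph T)"
      using E_ops[OF \<delta>E] that by (metis E'_def mem_Collect_eq)
    then show ?thesis
      unfolding D_def by (rule someI_ex)
  qed
  have ideal: "0 \<in> E'" "\<And>S T. S \<in> E' \<Longrightarrow> T \<in> E' \<Longrightarrow> S + T \<in> E'"
    "\<And>c T. T \<in> E' \<Longrightarrow> cop_scaleC c T \<in> E'"
    "\<And>U T. U \<in> M' \<Longrightarrow> T \<in> E' \<Longrightarrow> U * T \<in> E'" "\<And>U T. U \<in> M' \<Longrightarrow> T \<in> E' \<Longrightarrow> T * U \<in> E'"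
    using assms(3) by (auto simp: two_sided_ideal_def E'_def M'_def simp flip: cop_graph_simps)
  have norm: "norm_on E N" "complete_wrt E N"
    using assms(5) by (simp_all add: banach_bimodule_def)
  have N'_scaleC: "N' (cop_scaleC c T) = cmod c * N' T" if "T \<in> E'" for c T
    using norm(1) that by (simp add: norm_on_def E'_def N'_def flip: strong_scale_cop_graph)
  have N': "0 \<le> N' T" "N' T = 0 \<longleftrightarrow> T = 0" "S \<in> E' \<Longrightarrow> N' (S + T) \<le> N' S + N' T" if "T \<in> E'" for S T
    using norm(1) that unfolding norm_on_def E'_def N'_def
    by (auto simp: op_zero_eq cop_graph_eq_iff simp flip: strong_add_cop_graph)
  have complete: "\<exists>T\<in>E'. (\<lambda>n. N' (X n - T)) \<longlonglongrightarrow> 0"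
    if X: "\<And>n. X n \<in> E'" and Cauchy: "\<And>\<epsilon>. \<epsilon> > 0 \<Longrightarrow> \<exists>k. \<forall>m\<ge>k. \<forall>n\<ge>k. N' (X m - X n) < \<epsilon>"
    for X :: "nat \<Rightarrow> 'a cop"
  proof -
    have "\<forall>n. cop_graph (X n) \<in> E"
      using X by (simp add: E'_def)
    moreover have "\<forall>\<epsilon>>0. \<exists>k. \<forall>m\<ge>k. \<forall>n\<ge>k. N (strong_diff (cop_graph (X m)) (cop_graph (X n))) < \<epsilon>"
      using Cauchy by (simp add: strong_diff_cop_graph N'_def)
    ultimately have "\<exists>x\<in>E. (\<lambda>n. N (strong_diff (cop_graph (X n)) x)) \<longlonglongrightarrow> 0"
      using norm(2)[unfolded complete_wrt_def, THEN spec, of "\<lambda>n. cop_graph (X n)"] by simp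
    then obtain x where x: "x \<in> E" "(\<lambda>n. N (strong_diff (cop_graph (X n)) x)) \<longlonglongrightarrow> 0"
      by blast
    then obtain T where "x = cop_graph T"
      using E_ops by blast
    then show ?thesis
      using x by (auto simp: E'_def N'_def strong_diff_cop_graph)
  qed
  have banach: "banach_on E' N'"
  proof (unfold_locales, goal_cases)
    \<comment> \<open>Goals 3 and 7 concern real scalars, which are treated as complex ones.\<close>
    case (3 r x)
    then show ?case
      using ideal(3)[of x "complex_of_real r"] by (simp add: cop_scaleC_simps)
  next
    case (7 r x)
    then show ?case
      using N'_scaleC[of x "complex_of_real r"] by (simp add: cop_scaleC_simps)
  qed (use ideal N' complete in auto)
  have deriv: "\<delta> (strong_add x y) = strong_add (\<delta> x) (\<delta> y)"
    "\<delta> (strong_scale c x) = strong_scale c (\<delta> x)"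
    "\<delta> (strong_mult x y) = strong_add (strong_mult (\<delta> x) y) (strong_mult x (\<delta> y))"
    if "x \<in> E" "y \<in> E" for x y c
    using assms(6) that by (simp_all add: derivation_def)
  have DE: "D T \<in> E'" if "T \<in> E'" for T
    using D[OF that] \<delta>E[of "cop_graph T"] that by (simp add: E'_def)
  have E'M': "T \<in> M'" if "T \<in> E'" for T
    using that EM by (auto simp: E'_def M'_def)
  have D_rules: "D (S + T) = D S + D T" "D (cop_scaleC c S) = cop_scaleC c (D S)"
    "D (S * T) = D S * T + S * D T" if "S \<in> E'" "T \<in> E'" for S T c
  proof -
    have ST: "cop_graph S \<in> E" "cop_graph T \<in> E"
      using that by (simp_all add: E'_def)
    have "cop_graph (D (S + T)) = cop_graph (D S + D T)"
      using deriv(1)[OF ST] by (simp add: D that ideal flip: strong_add_cop_graph)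
    then show "D (S + T) = D S + D T"
      by (simp add: cop_graph_eq_iff)
    have "cop_graph (D (cop_scaleC c S)) = cop_graph (cop_scaleC c (D S))"
      using deriv(2)[OF ST] by (simp add: D that ideal flip: strong_scale_cop_graph)
    then show "D (cop_scaleC c S) = cop_scaleC c (D S)"
      by (simp add: cop_graph_eq_iff)
    have "cop_graph (D (S * T)) = cop_graph (D S * T + S * D T)"
      using deriv(3)[OF ST]
      by (simp add: D that ideal E'M' flip: strong_add_cop_graph strong_mult_cop_graph)
    then show "D (S * T) = D S * T + S * D T"
      by (simp add: cop_graph_eq_iff)
  qed
  have sandwich: "N' (U * T * V) \<le> norm U * norm V * N' T" if "U \<in> M'" "T \<in> E'" "V \<in> M'" for U T V
    using assms(5) that
    by (auto simp: banach_bimodule_def M'_def E'_def N'_def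
        simp flip: op_norm_cop_graph strong_mult_cop_graph)
  interpret ideal_derivation E' N' M' D
  proof (rule ideal_derivation.intro[OF banach], unfold_locales)
    show "closed_subalgebra M'"
      unfolding M'_def by (rule von_neumann_algebra_cop[OF vN])
    show "cop_scaleC c x \<in> M'" if "x \<in> M'" for c x
      using that unfolding M'_def by (rule von_neumann_algebra_cop[OF vN])
    show "\<exists>x'\<in>M'. is_adj x x'" if "x \<in> M'" for x
      using that unfolding M'_def by (rule von_neumann_algebra_cop[OF vN])
  qed (use E'M' ideal N'_scaleC sandwich DE D_rules in auto)
  obtain K where K: "\<And>T. T \<in> E' \<Longrightarrow> N' (D T) \<le> K * N' T"
    using derivation_bounded by blast
  show ?thesis
    unfolding norm_continuous_on_def
  proof (intro ballI allI impI)
    fix x and \<epsilon> :: real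
    assume x: "x \<in> E" and \<epsilon>: "\<epsilon> > 0"
    have le: "N (strong_diff (\<delta> y) (\<delta> x)) \<le> K * N (strong_diff y x)" if y: "y \<in> E" for y
    proof -
      obtain S T where ST: "x = cop_graph S" "y = cop_graph T"
        using E_ops x y by blast
      then have mem: "S \<in> E'" "T \<in> E'"
        using x y by (simp_all add: E'_def)
      have "D (T - S) = D T - D S"
        using D_add[OF mem(2) V_minus[OF mem(1)]] D_scaleR[OF mem(1), of "-1"] by simp
      then show ?thesis
        using K[OF V_diff[OF mem(2,1)]] mem
        by (simp add: ST N'_def strong_diff_cop_graph flip: D)
    qed
    \<comment> \<open>\<open>K\<close> may be zero or negative, so \<open>\<bar>K\<bar> + 1\<close>
      provides a positive denominator.\<close>
    define d where "d = \<epsilon> / (\<bar>K\<bar> + 1)"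
    have "d > 0"
      using \<epsilon> by (simp add: d_def add_nonneg_pos)
    moreover have "N (strong_diff (\<delta> y) (\<delta> x)) < \<epsilon>" if y: "y \<in> E" "N (strong_diff y x) < d" for y
    proof -
      obtain S T where ST: "x = cop_graph S" "y = cop_graph T"
        using E_ops x y by blast
      then have "0 \<le> N (strong_diff y x)"
        using x y N_nonneg[OF V_diff, of T S] by (simp add: E'_def N'_def strong_diff_cop_graph)
      then have "K * N (strong_diff y x) \<le> (\<bar>K\<bar> + 1) * N (strong_diff y x)"
        by (intro mult_right_mono) auto
      also have "\<dots> < (\<bar>K\<bar> + 1) * d"
        using y(2) by (intro mult_strict_left_mono) auto
      also have "\<dots> = \<epsilon>"
        by (simp add: d_def)
      finally show ?thesis
        using le[OF y(1)] by linarith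
    qed
    ultimately show "\<exists>d>0. \<forall>y\<in>E. N (strong_diff y x) < d \<longrightarrow> N (strong_diff (\<delta> y) (\<delta> x)) < \<epsilon>"
      by blast
  qed
qed

end
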